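(* Let $s=(s_1,\dots,s_n)$ be a composition and $0<\varepsilon<\frac{1}{n\left(1+\sum_{j=2}^n(2s_j+1)\right)}$. Then the function $\mathrm h_\varepsilon$ on routes of $\mathcal O(s)$ defined by $$\mathrm h_\varepsilon(R(k,t,\delta))=-\sum_{k\ge c>a\ge1}\varepsilon^{c-a}(t_c+\delta_a)^2,$$ where $t_k:=t$ and, for $c\in[k-1]$, $t_c:=0$ if $\delta_c=0$ and $t_c:=s_c$ if $\delta_c=1$, is an admissible height function for the DKK triangulation of $\mathcal F_{\mathcal O(s)}(\mathbf i)$.
   Context: $s_{n+1}:=2$. Graph $\mathcal O(s)$: vertices $v_{-1},\dots,v_n$; for $i\in[n+1]$ source edges $e^i_1,\dots,e^i_{s_i-1}$ from $v_{-1}$ to $v_{n+1-i}$; for $i\in[n]$ bump $e^i_0$ and dip $e^i_{s_i}$ from $v_{n-i}$ to $v_{n+1-i}$. Framing: incoming edges at $v_{n+1-i}$ ordered $e^i_0\prec e^i_1\prec\cdots\prec e^i_{s_i}$; outgoing at $v_{n+1-i}$ ordered $e^{i-1}_0\prec e^{i-1}_{s_{i-1}}$. Routes are paths $v_{-1}\to v_n$; $R(k,t,\delta)$ ($k\in[n+1]$, $t\in[s_k-1]$, $\delta\in\{0,1\}^{k-1}$) is the route with edges $e^k_t,e^{k-1}_{\delta_{k-1}s_{k-1}},\dots,e^1_{\delta_1s_1}$; every route has this form. Two routes $P,Q$ are coherent if on each maximal common subpath $v_a\cdots v_b$ with $v_a\ne v_{-1}$, $v_b\ne v_n$, $P$'s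 entering edge at $v_a$ precedes $Q$'s iff $P$'s leaving edge at $v_b$ precedes $Q$'s. $\mathcal F_{\mathcal O(s)}(\mathbf i)$ is the polytope of nonnegative unit flows from $v_{-1}$ to $v_n$, equal to $\mathrm{conv}\{\mathbf 1_R\}$ over routes $R$. The DKK triangulation consists of the simplices $\mathrm{conv}\{\mathbf 1_R : R\in C\}$ for sets $C$ of pairwise coherent routes. A function $\mathrm h$ from routes to $\mathbb R$ is an admissible height function for it if lifting each $\mathbf 1_R$ to height $\mathrm h(R)$ and projecting the lower faces of the convex hull of the lifted points yields exactly the DKK triangulation. *)

theory Defs
  imports "HOL-Analysis.Analysis" "HOL-Analysis.Finite_Function_Topology" "Graph_Theory.Arc_Walk"
begin

text \<open>
  A composition \<open>(s\<^sub>1, \<dots>, s\<^sub>n)\<close> is given by a function \<open>s :: nat \<Rightarrow> nat\<close>, positive on \<open>{1..n}\<close>,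
  together with \<open>n\<close>; the convention \<open>s\<^sub>n\<^sub>+\<^sub>1 = 2\<close> is a condition on \<open>s (n + 1)\<close>. The pair \<open>(i, j)\<close>
  stands for the edge with upper index \<open>i\<close> and lower index \<open>j\<close>, and the integer \<open>m\<close> for the vertex
  \<open>v\<^sub>m\<close>. Since \<open>s i > 0\<close>, the bump \<open>(i, 0)\<close>, the source edges \<open>(i, j)\<close> with \<open>0 < j < s i\<close>, and the dip
  \<open>(i, s i)\<close> are pairwise distinct.
\<close>

definition oruga :: "(nat \<Rightarrow> nat) \<Rightarrow> nat \<Rightarrow> (int, nat \<times> nat) pre_digraph" where
  "oruga s n =
    \<lparr> verts = {-1..int n},
      arcs = {(i, j). i \<in> {1..n+1} \<and> j \<in> {1..<s i}} \<union> {(i, j). i \<in> {1..n} \<and> j \<in> {0, s i}},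
      tail = (\<lambda>(i, j). if j \<in> {1..<s i} then -1 else int n - int i),
      head = (\<lambda>(i, j). int n + 1 - int i) \<rparr>"

definition routes :: "(nat \<Rightarrow> nat) \<Rightarrow> nat \<Rightarrow> (nat \<times> nat) list set" where
  "routes s n = {P. pre_digraph.apath (oruga s n) (-1) P (int n)}"

text \<open>Only the values of \<open>\<delta>\<close> on \<open>{1..k-1}\<close> matter.\<close>

definition route :: "(nat \<Rightarrow> nat) \<Rightarrow> nat \<Rightarrow> nat \<Rightarrow> (nat \<Rightarrow> nat) \<Rightarrow> (nat \<times> nat) list" where
  "route s k t \<delta> = (k, t) # map (\<lambda>c. (c, \<delta> c * s c)) (rev [1..<k])"

text \<open>
  The framing. The edges entering a given vertex all have the same upper index, and so do the edges
  leaving a given vertex other than \<open>v\<^sub>-\<^sub>1\<close>; both orders are the order of the lower indices.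
\<close>

definition precedes :: "nat \<times> nat \<Rightarrow> nat \<times> nat \<Rightarrow> bool" where
  "precedes e f \<longleftrightarrow> fst e = fst f \<and> snd e < snd f"

text \<open>
  A common subpath \<open>M\<close> (a single vertex if \<open>M = []\<close>) is maximal iff it is entered by different edges
  \<open>e, e'\<close> and left by different edges \<open>f, f'\<close>. The existence of these edges expresses that \<open>M\<close> does
  not start in \<open>v\<^sub>-\<^sub>1\<close> and does not end in \<open>v\<^sub>n\<close>.
\<close>

definition coherent :: "(nat \<Rightarrow> nat) \<Rightarrow> nat \<Rightarrow> (nat \<times> nat) list \<Rightarrow> (nat \<times> nat) list \<Rightarrow> bool" where
  "coherent s n P Q \<longleftrightarrow>
    (\<forall>M P\<^sub>1 e f P\<^sub>2 Q\<^sub>1 e' f' Q\<^sub>2.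
       P = P\<^sub>1 @ [e] @ M @ [f] @ P\<^sub>2 \<and> Q = Q\<^sub>1 @ [e'] @ M @ [f'] @ Q\<^sub>2 \<and>
       head (oruga s n) e = head (oruga s n) e' \<and> e \<noteq> e' \<and> f \<noteq> f'
       \<longrightarrow> (precedes e e' \<longleftrightarrow> precedes f f'))"

definition indicator_vector :: "'e list \<Rightarrow> ('e, real) poly_mapping" where
  "indicator_vector P = (\<Sum>e\<in>set P. Poly_Mapping.single e 1)"

text \<open>The flow polytope is the convex hull of the indicator vectors of all routes.\<close>

definition dkk_triangulation :: "(nat \<Rightarrow> nat) \<Rightarrow> nat \<Rightarrow> (nat \<times> nat, real) poly_mapping set set" where
  "dkk_triangulation s n =
    {convex hull (indicator_vector ` C) | C.
       C \<subseteq> routes s n \<and> C \<noteq> {} \<and> pairwise (coherent s n) C}"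

text \<open>
  The lower faces are the nonempty faces on which some linear functional with positive last
  coordinate, normalised to 1, is minimal.
\<close>

definition lower_face :: "('v::real_vector \<times> real) set \<Rightarrow> ('v \<times> real) set \<Rightarrow> bool" where
  "lower_face F L \<longleftrightarrow>
    F \<noteq> {} \<and>
    (\<exists>\<phi> :: 'v \<Rightarrow> real. linear \<phi> \<and>
       F = {(x, z) \<in> L. \<forall>(y, w) \<in> L. \<phi> x + z \<le> \<phi> y + w})"

definition admissible_height_function ::
    "(nat \<Rightarrow> nat) \<Rightarrow> nat \<Rightarrow> ((nat \<times> nat) list \<Rightarrow> real) \<Rightarrow> bool" where
  "admissible_height_function s n h \<longleftrightarrow>
    {fst ` F | F. lower_face F (convex hull ((\<lambda>P. (indicator_vector P, h P)) ` routes s n))}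
      = dkk_triangulation s n"

text \<open>
  A route determines \<open>k\<close>, \<open>t\<close> and the restriction of \<open>\<delta>\<close> to \<open>{1..k-1}\<close>, so functions on routes may
  be prescribed on the routes \<open>route s k t \<delta>\<close>.
\<close>

lemma route_eq_iff:
  assumes "k \<ge> 1" "k' \<ge> 1" "\<forall>c\<in>{1..<k}. s c > 0"
  shows "route s k t \<delta> = route s k' t' \<delta>' \<longleftrightarrow> k = k' \<and> t = t' \<and> (\<forall>c\<in>{1..<k}. \<delta> c = \<delta>' c)"
  using assms by (auto simp: route_def) (metis atLeastLessThan_iff less_numeral_extra(3))

end

(*
  A lower face of the lifted polytope is spanned by the routes minimising phi(1_R) + h(R) for a linear
  phi. If two routes are not coherent, swapping their tails at the conflict preserves the sum of the
  indicator vectors and, for small epsilon, lowers the total height; so the minimising routes are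
  pairwise coherent. Conversely, every flow has at most one decomposition into pairwise coherent
  routes, because at each vertex such routes are distributed monotonically over the outgoing edges.
  By the swapping argument a cheapest decomposition is coherent, so a coherent decomposition is
  strictly cheaper than any other decomposition of its flow, and Motzkin's theorem of the
  alternative yields a phi minimised exactly on a given coherent set.
*)
theory Submission
  imports Defs
begin

section \<open>Coherent sets and regular subdivisions\<close>

text \<open>Since \<delta>^2 = \<delta>, one has (t + \<delta>)^2 = t^2 + \<delta> (2 t + 1), so an
  exchange of tails is felt only where some \<delta>_a with a in the tail meets a t_d with d in the
  part before it. At a conflict entered at index c and left at index b, the route with the larger
  t_c has \<delta>_b = 0. The exchange pairs this t_c with \<delta>_b = 1 and so gains twice the
  difference of the two values t_c, with weight \<epsilon>^(c-b). In between, the routes agree and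
  nothing changes. Every other affected pair of indices is further apart and carries at least one
  more factor \<epsilon>. For each d there are at most n such pairs, with coefficients at most 2 s_d
  + 1. This is the origin of the bound on \<epsilon>. The converse needs a cheapest decomposition to
  exist, which is a compactness argument. Strictness matters because a relation produced by the
  theorem of the alternative can be negative on the coherent set only; a large constant weight added
  there turns it into a competing decomposition of the same flow.\<close>

lemma lookup_scaleR [simp]: "Poly_Mapping.lookup (c *\<^sub>R x) e = c *\<^sub>R Poly_Mapping.lookup x e"
  by (simp add: scaleR_poly_mapping_def)

text \<open>
  Bartl's proof: if \<open>f\<^sub>i\<close> is indispensable, some \<open>z\<close> with \<open>f\<^sub>i z = -1\<close> shows it, and the
  projection along \<open>z\<close> onto the kernel of \<open>f\<^sub>i\<close> reduces the claim to the other functionals.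
\<close>

lemma farkas:
  fixes f :: "'i \<Rightarrow> 'w::real_vector \<Rightarrow> real"
  assumes "finite I" "\<And>i. i \<in> I \<Longrightarrow> linear (f i)" "linear g"
    and "\<And>x. (\<And>i. i \<in> I \<Longrightarrow> f i x \<ge> 0) \<Longrightarrow> g x \<ge> 0"
  shows "\<exists>u. (\<forall>i\<in>I. u i \<ge> 0) \<and> (\<forall>x. g x = (\<Sum>i\<in>I. u i * f i x))"
  using assms
proof (induction I arbitrary: f g rule: finite_induct)
  case empty
  have "g x = 0" for x
    using empty(3)[of x] empty(3)[of "-x"] linear_neg[OF empty(2), of x] by auto
  then show ?case by auto
next
  case (insert j I)
  show ?case
  proof (cases "\<forall>x. (\<forall>i\<in>I. f i x \<ge> 0) \<longrightarrow> g x \<ge> 0")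
    case True
    then obtain l where l: "\<forall>i\<in>I. l i \<ge> 0" "\<forall>x. g x = (\<Sum>i\<in>I. l i * f i x)"
      using insert.IH[of f g] insert.prems by auto
    have "(\<Sum>i\<in>insert j I. (l(j := 0)) i * f i x) = (\<Sum>i\<in>I. l i * f i x)" for x
      using insert.hyps by (auto intro!: sum.cong)
    with l show ?thesis
      by (intro exI[of _ "l(j := 0)"]) auto
  next
    case False
    then obtain y where y: "\<forall>i\<in>I. f i y \<ge> 0" "g y < 0"
      by (auto simp: not_le)
    have fj: "linear (f j)" using insert.prems by auto
    have neg: "f j y < 0"
      using insert.prems(3)[of y] y by (metis insert_iff not_le)
    define z where "z = (- 1 / f j y) *\<^sub>R y"
    have fz: "f j z = - 1"
      using neg unfolding z_def linear_scale[OF fj] by simp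
    have iz: "f i z \<ge> 0" if "i \<in> I" for i
    proof -
      have "linear (f i)" using insert.prems(1) that by auto
      then have "f i z = (- 1 / f j y) * f i y" by (simp only: z_def linear_scale real_scaleR_def)
      moreover have "f i y \<ge> 0" using y(1) that by blast
      ultimately show ?thesis using neg by (simp add: divide_nonneg_neg)
    qed
    have gz: "g z < 0"
    proof -
      have "g z = (- 1 / f j y) * g y"
        by (simp only: z_def linear_scale[OF insert.prems(2)] real_scaleR_def)
      then show ?thesis using y(2) neg by (simp add: divide_neg_neg)
    qed
    define pr where "pr x = x + f j x *\<^sub>R z" for x
    have prl: "linear pr"
      unfolding pr_def using fj
      by (auto intro!: linearI simp: linear_add linear_scale algebra_simps)
    have fpr: "f j (pr x) = 0" for x
      by (simp add: pr_def linear_add[OF fj] linear_scale[OF fj] fz)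
    have "\<exists>l. (\<forall>i\<in>I. l i \<ge> 0) \<and> (\<forall>x. (g \<circ> pr) x = (\<Sum>i\<in>I. l i * (f i \<circ> pr) x))"
    proof (rule insert.IH)
      show "linear (f i \<circ> pr)" if "i \<in> I" for i
        using insert.prems(1) that linear_compose[OF prl] by auto
      show "linear (g \<circ> pr)"
        using insert.prems(2) linear_compose[OF prl] by auto
      show "(g \<circ> pr) x \<ge> 0" if "\<And>i. i \<in> I \<Longrightarrow> (f i \<circ> pr) x \<ge> 0" for x
        using insert.prems(3)[of "pr x"] that fpr by (metis comp_apply insert_iff order_refl)
    qed
    then obtain l where l: "\<forall>i\<in>I. l i \<ge> 0" "\<And>x. g (pr x) = (\<Sum>i\<in>I. l i * f i (pr x))"
      by auto
    define c where "c = (\<Sum>i\<in>I. l i * f i z) - g z"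
    have c: "c \<ge> 0"
      using gz l(1) iz sum_nonneg[of I "\<lambda>i. l i * f i z"] by (auto simp: c_def)
    have "g x = (\<Sum>i\<in>insert j I. (l(j := c)) i * f i x)" for x
    proof -
      have "g x + f j x * g z = g (pr x)"
        by (simp add: pr_def linear_add[OF insert.prems(2)] linear_scale[OF insert.prems(2)])
      also have "\<dots> = (\<Sum>i\<in>I. l i * f i x + f j x * (l i * f i z))"
        unfolding l(2)
        by (rule sum.cong)
           (auto simp: pr_def insert.prems(1) linear_add linear_scale algebra_simps)
      also have "\<dots> = (\<Sum>i\<in>I. l i * f i x) + f j x * (\<Sum>i\<in>I. l i * f i z)"
        by (simp add: sum.distrib sum_distrib_left)
      finally have "g x = (\<Sum>i\<in>I. l i * f i x) + c * f j x"
        by (simp add: c_def algebra_simps)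
      moreover have "(\<Sum>i\<in>I. l i * f i x) = (\<Sum>i\<in>I. (l(j := c)) i * f i x)"
        using insert.hyps by (auto intro!: sum.cong)
      ultimately show ?thesis
        using insert.hyps by simp
    qed
    with l(1) c show ?thesis
      by (intro exI[of _ "l(j := c)"]) auto
  qed
qed

text \<open>If some \<open>f j\<close> with \<open>j\<close> outside \<open>C\<close> could not be
  made positive while the other functionals stay nonnegative and vanish on \<open>C\<close>, then
  Farkas' lemma for \<open>- f j\<close> would give a relation that \<open>no\<close> excludes.
  Adding up one solution for each \<open>j\<close> makes all of them positive at once.\<close>

lemma motzkin:
  fixes f :: "'i \<Rightarrow> 'w::real_vector \<Rightarrow> real"
  assumes fin: "finite I" and lin: "\<And>i. i \<in> I \<Longrightarrow> linear (f i)" and "C \<subseteq> I"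
    and no: "\<And>u. (\<And>i. i \<in> I - C \<Longrightarrow> u i \<ge> 0) \<Longrightarrow> (\<And>x. (\<Sum>i\<in>I. u i * f i x) = 0) \<Longrightarrow>
               \<forall>i\<in>I-C. u i = 0"
  shows "\<exists>x. (\<forall>i\<in>C. f i x = 0) \<and> (\<forall>i\<in>I-C. f i x > 0)"
proof -
  have "\<exists>x. (\<forall>i\<in>C. f i x = 0) \<and> (\<forall>i\<in>I-C. f i x \<ge> 0) \<and> f j x > 0" if j: "j \<in> I - C" for j
  proof (rule ccontr)
    assume neg: "\<not> ?thesis"
    \<comment> \<open>Each equation on \<open>C\<close> enters as two opposite inequalities; the tag
      \<open>False\<close> marks the negated copy.\<close>
    define F where "F = (\<lambda>(b, i) x. if b then f i x else - f i x)"
    define J where "J = {True} \<times> I \<union> {False} \<times> C"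
    have "\<exists>l. (\<forall>i\<in>J. l i \<ge> 0) \<and> (\<forall>x. - f j x = (\<Sum>i\<in>J. l i * F i x))"
    proof (rule farkas)
      show "finite J"
        using fin \<open>C \<subseteq> I\<close> by (auto simp: J_def intro: finite_subset)
      show "linear (F i)" if "i \<in> J" for i
      proof -
        have "linear (f (snd i))" using that lin \<open>C \<subseteq> I\<close> by (auto simp: J_def)
        then show ?thesis
          using linear_compose_neg[of "f (snd i)"]
          by (cases i; cases "fst i") (simp_all add: F_def)
      qed
      show "linear (\<lambda>x. - f j x)"
        using j lin by (auto intro: linear_compose_neg)
      show "- f j x \<ge> 0" if x: "\<And>i. i \<in> J \<Longrightarrow> F i x \<ge> 0" for x
      proof -
        have "f i x \<ge> 0" if "i \<in> I" for i
          using x[of "(True, i)"] that by (auto simp: J_def F_def)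
        moreover have "f i x \<le> 0" if "i \<in> C" for i
          using x[of "(False, i)"] that by (auto simp: J_def F_def)
        ultimately show ?thesis
          using neg \<open>C \<subseteq> I\<close> by (meson DiffD1 antisym not_le neg_0_le_iff_le subsetD)
      qed
    qed
    then obtain l where l: "\<forall>i\<in>J. l i \<ge> 0" "\<And>x. - f j x = (\<Sum>i\<in>J. l i * F i x)"
      by auto
    \<comment> \<open>Bringing \<open>- f j\<close> to the other side adds 1 to the coefficient at
      \<open>j\<close>, so the relation does not vanish there.\<close>
    define m where "m i = l (True, i) - (if i \<in> C then l (False, i) else 0) + (if i = j then 1 else 0)" for i
    have m: "m i \<ge> 0" "i = j \<Longrightarrow> m i \<ge> 1" if "i \<in> I - C" for i
      using that l(1) by (auto simp: m_def J_def)
    have "(\<Sum>i\<in>I. m i * f i x) = 0" for x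
    proof -
      have "(\<Sum>i\<in>J. l i * F i x) = (\<Sum>i\<in>I. l (True, i) * f i x) - (\<Sum>i\<in>C. l (False, i) * f i x)"
      proof -
        have "finite C" using fin \<open>C \<subseteq> I\<close> finite_subset by blast
        then have "(\<Sum>i\<in>J. l i * F i x) = (\<Sum>i\<in>{True} \<times> I. l i * F i x) + (\<Sum>i\<in>{False} \<times> C. l i * F i x)"
          unfolding J_def using fin by (intro sum.union_disjoint) auto
        moreover have "{b} \<times> A = Pair b ` A" for b :: bool and A :: "'i set" by auto
        ultimately show ?thesis
          by (simp add: sum.reindex inj_on_def F_def sum_negf)
      qed
      moreover have "(\<Sum>i\<in>C. l (False, i) * f i x) = (\<Sum>i\<in>I. (if i \<in> C then l (False, i) else 0) * f i x)"
        using fin \<open>C \<subseteq> I\<close> by (intro sum.mono_neutral_cong_left) auto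
      moreover have "f j x = (\<Sum>i\<in>I. (if i = j then 1 else 0) * f i x)"
        using fin j by (simp add: if_distrib[of "\<lambda>a. a * _"] sum.delta cong: if_cong)
      ultimately show ?thesis
        using l(2)[of x] by (simp add: m_def algebra_simps sum.distrib sum_subtractf)
    qed
    then have "\<forall>i\<in>I-C. m i = 0"
      using m(1) by (intro no) auto
    then have "m j = 0" using j by blast
    with m(2)[OF j] show False by simp
  qed
  then obtain x where x: "\<And>j. j \<in> I - C \<Longrightarrow>
      (\<forall>i\<in>C. f i (x j) = 0) \<and> (\<forall>i\<in>I-C. f i (x j) \<ge> 0) \<and> f j (x j) > 0"
    by metis
  define y where "y = (\<Sum>j\<in>I-C. x j)"
  have y: "f i y = (\<Sum>j\<in>I-C. f i (x j))" if "i \<in> I" for i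
    unfolding y_def using linear_sum[OF lin[OF that]] .
  have "f i y > 0" if i: "i \<in> I - C" for i
  proof -
    have "f i (x i) \<le> (\<Sum>j\<in>I-C. f i (x j))"
      using x i fin by (intro member_le_sum) auto
    then show ?thesis using x[OF i] i y[of i] by auto
  qed
  moreover have "f i y = 0" if "i \<in> C" for i
    using y[of i] that x \<open>C \<subseteq> I\<close> by (auto intro!: sum.neutral)
  ultimately show ?thesis by blast
qed

text \<open>A convex combination attains the minimum \<open>m\<close> of a linear functional exactly
  when every generator with a larger value has weight 0. Working with the set \<open>S\<close> of
  lifted points avoids any injectivity of \<open>v\<close>.\<close>

lemma fst_minimal_face:
  fixes v :: "'i \<Rightarrow> 'v::real_vector" and h :: "'i \<Rightarrow> real"
  assumes fin: "finite I" and phi: "linear \<phi>" and I: "I \<noteq> {}"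
  defines "L \<equiv> convex hull ((\<lambda>i. (v i, h i)) ` I)"
  shows "fst ` {(x, z) \<in> L. \<forall>(y, w) \<in> L. \<phi> x + z \<le> \<phi> y + w} =
      convex hull (v ` {i\<in>I. \<forall>j\<in>I. \<phi> (v i) + h i \<le> \<phi> (v j) + h j})"
proof -
  define S where "S = (\<lambda>i. (v i, h i :: real)) ` I"
  define g where "g p = \<phi> (fst p) + snd p" for p :: "'v \<times> real"
  have g: "linear g"
    unfolding g_def using phi by (auto intro!: linearI simp: linear_add linear_scale algebra_simps)
  have finS: "finite S" and neS: "S \<noteq> {}" using fin I by (auto simp: S_def)
  define m where "m = Min (g ` S)"
  have m: "m \<le> g p" if "p \<in> S" for p using that finS by (auto simp: m_def)
  have "m \<in> g ` S" unfolding m_def using finS neS by (intro Min_in) auto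
  then obtain p0 where p0: "p0 \<in> S" "g p0 = m" by auto
  have L: "L = {y. \<exists>u. (\<forall>x\<in>S. 0 \<le> u x) \<and> sum u S = 1 \<and> (\<Sum>x\<in>S. u x *\<^sub>R x) = y}"
    unfolding L_def S_def[symmetric] by (rule convex_hull_finite[OF finS])
  have gsum: "g (\<Sum>x\<in>S. u x *\<^sub>R x) = (\<Sum>x\<in>S. u x * g x)" for u
    by (simp add: linear_sum[OF g] linear_scale[OF g])
  have mL: "m \<le> g p" if "p \<in> L" for p
  proof -
    obtain u where u: "\<forall>x\<in>S. 0 \<le> u x" "sum u S = 1" "(\<Sum>x\<in>S. u x *\<^sub>R x) = p"
      using \<open>p \<in> L\<close> by (auto simp: L)
    have "(\<Sum>x\<in>S. u x * m) \<le> (\<Sum>x\<in>S. u x * g x)"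
      using u m by (intro sum_mono mult_left_mono) auto
    then show ?thesis using u gsum[of u] by (simp add: sum_distrib_right[symmetric])
  qed
  have SL: "S \<subseteq> L" unfolding L_def S_def by (rule hull_subset)
  have "{(x, z) \<in> L. \<forall>(y, w) \<in> L. \<phi> x + z \<le> \<phi> y + w} = {p \<in> L. \<forall>q\<in>L. g p \<le> g q}"
    by (auto simp: g_def)
  also have "\<dots> = {p \<in> L. g p = m}"
    using mL p0 SL by (auto intro!: antisym)
  also have "\<dots> = convex hull {p\<in>S. g p = m}"
  proof (intro equalityI subsetI)
    fix p assume "p \<in> {p \<in> L. g p = m}"
    then obtain u where u: "\<forall>x\<in>S. 0 \<le> u x" "sum u S = 1" "(\<Sum>x\<in>S. u x *\<^sub>R x) = p" "g p = m"
      by (auto simp: L)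
    have "(\<Sum>x\<in>S. u x * (g x - m)) = 0"
      using u gsum[of u] by (simp add: right_diff_distrib sum_subtractf sum_distrib_right[symmetric])
    then have z: "u x = 0" if "x \<in> S" "g x \<noteq> m" for x
      using that u(1) m finS by (subst (asm) sum_nonneg_eq_0_iff) auto
    have "sum u {p\<in>S. g p = m} = sum u S"
      using finS z by (intro sum.mono_neutral_left) auto
    moreover have "(\<Sum>x\<in>{p\<in>S. g p = m}. u x *\<^sub>R x) = (\<Sum>x\<in>S. u x *\<^sub>R x)"
      using finS z by (intro sum.mono_neutral_left) auto
    ultimately show "p \<in> convex hull {p\<in>S. g p = m}"
      using finS u by (auto simp: convex_hull_finite)
  next
    fix p assume p: "p \<in> convex hull {p\<in>S. g p = m}"
    have "convex {p. g p = m}"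
      using g by (auto simp: convex_def linear_add linear_scale algebra_simps simp flip: distrib_right)
    then have "convex hull {p\<in>S. g p = m} \<subseteq> {p. g p = m}"
      by (intro hull_minimal) auto
    moreover have "convex hull {p\<in>S. g p = m} \<subseteq> L"
      unfolding L_def S_def by (rule hull_mono) auto
    ultimately show "p \<in> {p \<in> L. g p = m}" using p by auto
  qed
  finally have "fst ` {(x, z) \<in> L. \<forall>(y, w) \<in> L. \<phi> x + z \<le> \<phi> y + w} = convex hull (fst ` {p\<in>S. g p = m})"
    by (simp add: convex_hull_linear_image linear_fst)
  moreover have "{p\<in>S. g p = m} = {p\<in>S. \<forall>q\<in>S. g p \<le> g q}"
    using m p0 by (auto intro!: antisym)
  moreover have "fst ` {p\<in>S. \<forall>q\<in>S. g p \<le> g q} = v ` {i\<in>I. \<forall>j\<in>I. \<phi> (v i) + h i \<le> \<phi> (v j) + h j}"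
    by (force simp: S_def g_def)
  ultimately show ?thesis by simp
qed

section \<open>From exchange and uniqueness to the lower faces of the lifted hull\<close>

context
  fixes I :: "'i set" and v :: "'i \<Rightarrow> ('e, real) poly_mapping" and h :: "'i \<Rightarrow> real"
    and coh :: "'i \<Rightarrow> 'i \<Rightarrow> bool"
  assumes finite_I: "finite I"
    and v_nonneg: "\<And>i e. i \<in> I \<Longrightarrow> Poly_Mapping.lookup (v i) e \<ge> 0"
    and v_nonzero: "\<And>i. i \<in> I \<Longrightarrow> v i \<noteq> 0"
    and exchange: "\<And>i j. i \<in> I \<Longrightarrow> j \<in> I \<Longrightarrow> i \<noteq> j \<Longrightarrow> \<not> coh i j \<Longrightarrow>
        \<exists>i'\<in>I. \<exists>j'\<in>I. v i' + v j' = v i + v j \<and> h i' + h j' < h i + h j"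
    and unique: "\<And>u w. (\<And>i. i \<in> I \<Longrightarrow> u i \<ge> 0) \<Longrightarrow> (\<And>i. i \<in> I \<Longrightarrow> w i \<ge> 0) \<Longrightarrow>
        pairwise coh {i\<in>I. u i \<noteq> 0} \<Longrightarrow> pairwise coh {i\<in>I. w i \<noteq> 0} \<Longrightarrow>
        (\<Sum>i\<in>I. u i *\<^sub>R v i) = (\<Sum>i\<in>I. w i *\<^sub>R v i) \<Longrightarrow> \<forall>i\<in>I. u i = w i"
begin

text \<open>The weights need not add up to 1: points of a cone are decomposed. This is why the
  supporting functional found below can be normalised to have minimum 0.\<close>

definition decomposition :: "('e, real) poly_mapping \<Rightarrow> ('i \<Rightarrow> real) \<Rightarrow> bool" where
  "decomposition x u \<longleftrightarrow> (\<forall>i\<in>I. u i \<ge> 0) \<and> (\<Sum>i\<in>I. u i *\<^sub>R v i) = x"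

text \<open>Moving the weight \<open>min (u i) (u j)\<close> from an incoherent pair to the pair
  supplied by \<open>exchange\<close> keeps the flow and lowers the cost.\<close>

lemma cheapest_decomposition_coherent:
  assumes u: "decomposition x u"
    and min: "\<And>w. decomposition x w \<Longrightarrow> (\<Sum>i\<in>I. u i * h i) \<le> (\<Sum>i\<in>I. w i * h i)"
  shows "pairwise coh {i\<in>I. u i \<noteq> 0}"
proof (rule ccontr)
  assume "\<not> ?thesis"
  then obtain i j where ij: "i \<in> I" "j \<in> I" "i \<noteq> j" "u i \<noteq> 0" "u j \<noteq> 0" "\<not> coh i j"
    by (auto simp: pairwise_def)
  obtain i' j' where ij': "i' \<in> I" "j' \<in> I" "v i' + v j' = v i + v j" "h i' + h j' < h i + h j"
    using exchange[OF ij(1-3,6)] by auto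
  define c where "c = min (u i) (u j)"
  have pos: "u i > 0" "u j > 0" using u ij by (auto simp: decomposition_def order_less_le)
  then have c: "c > 0" by (simp add: c_def)
  \<comment> \<open>Unit weights are added, rather than single values updated, so that
    \<open>i'\<close> and \<open>j'\<close> may coincide with each other or with \<open>i\<close> or
    \<open>j\<close>.\<close>
  define d where "d a b = (if b = a then 1 else 0 :: real)" for a b :: 'i
  define w where "w a = u a + c * (d i' a + d j' a - d i a - d j a)" for a
  have nn: "w a \<ge> 0" if "a \<in> I" for a
  proof -
    have "u a \<ge> c * (d i a + d j a)"
      using u that ij(3) by (auto simp: d_def c_def decomposition_def)
    moreover have "c * (d i' a + d j' a) \<ge> 0" using c by (simp add: d_def)
    ultimately show ?thesis by (simp add: w_def algebra_simps)
  qed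
  have dv: "(\<Sum>b\<in>I. d a b *\<^sub>R v b) = v a" "(\<Sum>b\<in>I. d a b * h b) = h a" if "a \<in> I" for a
    using that finite_I
    by (simp_all add: d_def if_distrib[of "\<lambda>t. t *\<^sub>R _"] if_distrib[of "\<lambda>t. t * _"] cong: if_cong)
  have "(\<Sum>a\<in>I. w a *\<^sub>R v a) = (\<Sum>a\<in>I. u a *\<^sub>R v a) + c *\<^sub>R (v i' + v j' - v i - v j)"
  proof -
    have "(\<Sum>a\<in>I. w a *\<^sub>R v a) = (\<Sum>a\<in>I. u a *\<^sub>R v a + c *\<^sub>R (d i' a *\<^sub>R v a + d j' a *\<^sub>R v a
         - d i a *\<^sub>R v a - d j a *\<^sub>R v a))"
      by (rule sum.cong) (auto simp: w_def algebra_simps)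
    also have "\<dots> = (\<Sum>a\<in>I. u a *\<^sub>R v a) + c *\<^sub>R (v i' + v j' - v i - v j)"
      using ij ij' by (simp add: sum.distrib sum_subtractf dv flip: scaleR_sum_right)
    finally show ?thesis .
  qed
  also have "\<dots> = x" using u ij'(3) by (simp add: decomposition_def)
  finally have "decomposition x w" using nn by (auto simp: decomposition_def)
  moreover have "(\<Sum>a\<in>I. w a * h a) = (\<Sum>a\<in>I. u a * h a) + c * (h i' + h j' - h i - h j)"
  proof -
    have "(\<Sum>a\<in>I. w a * h a) = (\<Sum>a\<in>I. u a * h a + c * (d i' a * h a + d j' a * h a
         - d i a * h a - d j a * h a))"
      by (rule sum.cong) (auto simp: w_def algebra_simps)
    also have "\<dots> = (\<Sum>a\<in>I. u a * h a) + c * (h i' + h j' - h i - h j)"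
      using ij ij' by (simp add: sum.distrib sum_subtractf dv flip: sum_distrib_left)
    finally show ?thesis .
  qed
  moreover have "c * (h i' + h j' - h i - h j) < 0"
    using c ij'(4) by (intro mult_pos_neg) auto
  ultimately show False using min[of w] by linarith
qed

text \<open>Compactness: each \<open>v i\<close> is nonnegative with some positive entry, and this
  entry bounds the weight of \<open>i\<close> in every decomposition of \<open>x\<close>.\<close>

lemma cheapest_decomposition_exists:
  assumes u0: "decomposition x u0"
  shows "\<exists>u. decomposition x u \<and>
    (\<forall>w. decomposition x w \<longrightarrow> (\<Sum>i\<in>I. u i * h i) \<le> (\<Sum>i\<in>I. w i * h i))"
proof -
  have "\<exists>e. Poly_Mapping.lookup (v i) e > 0" if "i \<in> I" for i
    using v_nonneg[OF that] v_nonzero[OF that] by (metis lookup_zero order_less_le poly_mapping_eqI)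
  then obtain e where e: "\<And>i. i \<in> I \<Longrightarrow> Poly_Mapping.lookup (v i) (e i) > 0" by metis
  \<comment> \<open>Weights outside \<open>I\<close> are pinned to 0, so the product over the whole
    type is compact.\<close>
  define B where "B i = (if i \<in> I then {0..Poly_Mapping.lookup x (e i) / Poly_Mapping.lookup (v i) (e i)} else {0})" for i
  define S where "S = PiE UNIV B \<inter> {u. \<forall>e. (\<Sum>i\<in>I. u i * Poly_Mapping.lookup (v i) e) = Poly_Mapping.lookup x e}"
  have cont: "continuous_on UNIV (\<lambda>u :: 'i \<Rightarrow> real. \<Sum>i\<in>I. u i * g i)" for g
    by (intro continuous_intros continuous_on_product_coordinates)
  have "compactin (product_topology (\<lambda>_. euclidean) UNIV) (PiE UNIV B)"
    unfolding compactin_PiE by (auto simp: B_def)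
  then have "compact (PiE UNIV B)"
    by (simp add: euclidean_product_topology)
  moreover have "closed {u. \<forall>e. (\<Sum>i\<in>I. u i * Poly_Mapping.lookup (v i) e) = Poly_Mapping.lookup x e}"
    by (intro closed_Collect_all closed_Collect_eq cont continuous_on_const)
  ultimately have S: "compact S" unfolding S_def by (rule compact_Int_closed)
  have dec: "(\<lambda>i. if i \<in> I then w i else 0) \<in> S" if w: "decomposition x w" for w
  proof -
    have eq: "(\<Sum>i\<in>I. w i * Poly_Mapping.lookup (v i) a) = Poly_Mapping.lookup x a" for a
      using w by (auto simp: decomposition_def lookup_sum)
    have "w i \<le> Poly_Mapping.lookup x (e i) / Poly_Mapping.lookup (v i) (e i)" if i: "i \<in> I" for i
    proof -
      have "w i * Poly_Mapping.lookup (v i) (e i) \<le> Poly_Mapping.lookup x (e i)"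
        unfolding eq[symmetric] using i w finite_I v_nonneg
        by (intro member_le_sum) (auto simp: decomposition_def)
      then show ?thesis using e[OF i] by (simp add: field_simps)
    qed
    then show ?thesis using w eq by (auto simp: S_def B_def decomposition_def)
  qed
  obtain u where u: "u \<in> S" "\<forall>w\<in>S. (\<Sum>i\<in>I. u i * h i) \<le> (\<Sum>i\<in>I. w i * h i)"
    using continuous_attains_inf[OF S, of "\<lambda>u. \<Sum>i\<in>I. u i * h i"] dec[OF u0]
      continuous_on_subset[OF cont] by blast
  have "decomposition x u"
    using u(1) by (auto simp: S_def B_def decomposition_def lookup_sum PiE_iff intro!: poly_mapping_eqI)
      (metis atLeastAtMost_iff)
  moreover have "(\<Sum>i\<in>I. u i * h i) \<le> (\<Sum>i\<in>I. w i * h i)" if "decomposition x w" for w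
    using u(2) dec[OF that] by fastforce
  ultimately show ?thesis by blast
qed

text \<open>A cheapest decomposition is coherent, hence equals \<open>u\<close> by uniqueness. So
  \<open>u\<close> is cheapest, a \<open>w\<close> that costs no more is cheapest too, hence
  coherent, and uniqueness applies again.\<close>

lemma coherent_decomposition_strictly_cheapest:
  assumes u: "decomposition x u" "pairwise coh {i\<in>I. u i \<noteq> 0}"
    and w: "decomposition x w" "(\<Sum>i\<in>I. w i * h i) \<le> (\<Sum>i\<in>I. u i * h i)"
  shows "\<forall>i\<in>I. w i = u i"
proof -
  have eq: "\<forall>i\<in>I. w i = u i" if "decomposition x w" "pairwise coh {i\<in>I. w i \<noteq> 0}" for w
  proof (rule unique)
    show "(\<Sum>i\<in>I. w i *\<^sub>R v i) = (\<Sum>i\<in>I. u i *\<^sub>R v i)"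
      using that(1) u(1) by (simp add: decomposition_def)
  qed (use that u in \<open>simp_all add: decomposition_def\<close>)
  obtain m where m: "decomposition x m"
      "\<And>w. decomposition x w \<Longrightarrow> (\<Sum>i\<in>I. m i * h i) \<le> (\<Sum>i\<in>I. w i * h i)"
    using cheapest_decomposition_exists[OF u(1)] by blast
  have "\<forall>i\<in>I. m i = u i"
    using eq[OF m(1) cheapest_decomposition_coherent[OF m]] .
  then have "(\<Sum>i\<in>I. m i * h i) = (\<Sum>i\<in>I. u i * h i)" by simp
  then have "pairwise coh {i\<in>I. w i \<noteq> 0}"
    using m w by (intro cheapest_decomposition_coherent[of x]) (auto intro: order_trans)
  then show ?thesis using eq w by blast
qed

text \<open>The unknown is a pair \<open>(w, t)\<close> of a price vector and a positive scale for
  the heights, which makes the conditions homogeneous: value 0 on \<open>C\<close>, positive value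
  off \<open>C\<close>. A relation among these conditions, added to a constant weight on
  \<open>C\<close>, is a decomposition of the same flow at no higher cost and therefore
  trivial.\<close>

lemma coherent_set_supported:
  assumes C: "C \<subseteq> I" "C \<noteq> {}" "pairwise coh C"
  shows "\<exists>\<phi>. linear \<phi> \<and> {i\<in>I. \<forall>j\<in>I. \<phi> (v i) + h i \<le> \<phi> (v j) + h j} = C"
proof -
  define E where "E = (\<Union>i\<in>I. Poly_Mapping.keys (v i))"
  have E: "finite E" using finite_I by (auto simp: E_def)
  define pair where "pair w x = (\<Sum>e\<in>E. Poly_Mapping.lookup w e * Poly_Mapping.lookup x e)"
    for w x :: "('e, real) poly_mapping"
  \<comment> \<open>\<open>None\<close> stands for the condition \<open>t > 0\<close>, and
    \<open>Some i\<close> for the value at \<open>i\<close>.\<close>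
  define f where "f k p = (case k of None \<Rightarrow> snd p | Some i \<Rightarrow> pair (fst p) (v i) + snd p * h i)"
    for k and p :: "('e, real) poly_mapping \<times> real"
  have "\<exists>p. (\<forall>k\<in>Some ` C. f k p = 0) \<and> (\<forall>k\<in>insert None (Some ` I) - Some ` C. f k p > 0)"
  proof (rule motzkin)
    show "finite (insert None (Some ` I))" using finite_I by simp
    show "linear (f k)" for k
    proof (cases k)
      case None
      then have "f k = snd" by (simp add: fun_eq_iff f_def)
      then show ?thesis by (simp add: linear_snd)
    next
      case (Some i)
      have "linear (\<lambda>p. pair (fst p) (v i))"
        by (rule linearI)
           (simp_all only: pair_def fst_add fst_scaleR lookup_add lookup_scaleR real_scaleR_def
              distrib_right sum.distrib sum_distrib_left mult.assoc)
      moreover have "linear (\<lambda>p :: ('e, real) poly_mapping \<times> real. snd p * h i)"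
        by (rule linearI) (simp_all add: distrib_right)
      ultimately have lin: "linear (\<lambda>p. pair (fst p) (v i) + snd p * h i)"
        by (rule linear_compose_add)
      have "f k = (\<lambda>p. pair (fst p) (v i) + snd p * h i)"
        using Some by (simp add: fun_eq_iff f_def)
      with lin show ?thesis by simp
    qed
    show "Some ` C \<subseteq> insert None (Some ` I)" using C by auto
    fix u
    assume u: "\<And>k. k \<in> insert None (Some ` I) - Some ` C \<Longrightarrow> u k \<ge> 0"
      and z: "\<And>p. (\<Sum>k\<in>insert None (Some ` I). u k * f k p) = 0"
    have z': "u None * t + (\<Sum>i\<in>I. u (Some i) * (pair w (v i) + t * h i)) = 0" for w t
      using z[of "(w, t)"] finite_I by (simp add: f_def sum.reindex)
    have flow: "(\<Sum>i\<in>I. u (Some i) *\<^sub>R v i) = 0"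
    proof (rule poly_mapping_eqI)
      fix e
      show "Poly_Mapping.lookup (\<Sum>i\<in>I. u (Some i) *\<^sub>R v i) e = Poly_Mapping.lookup 0 e"
      proof (cases "e \<in> E")
        case True
        have "pair (Poly_Mapping.single e 1) (v i) = Poly_Mapping.lookup (v i) e" for i
        proof -
          have "pair (Poly_Mapping.single e 1) (v i) = (\<Sum>a\<in>E. if a = e then Poly_Mapping.lookup (v i) e else 0)"
            unfolding pair_def by (rule sum.cong) (auto simp: lookup_single when_def)
          then show ?thesis using True E by simp
        qed
        then show ?thesis using z'[of 0 "Poly_Mapping.single e 1"] by (simp add: lookup_sum)
      next
        case False
        then have "Poly_Mapping.lookup (v i) e = 0" if "i \<in> I" for i
          using that by (auto simp: E_def in_keys_iff)
        then show ?thesis by (simp add: lookup_sum)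
      qed
    qed
    \<comment> \<open>Testing the relation at \<open>t = 1\<close>, \<open>w = 0\<close> shows that
      its total height is at most 0, because \<open>u None\<close> is nonnegative.\<close>
    have height: "(\<Sum>i\<in>I. u (Some i) * h i) = - u None"
      using z'[of 1 0] by (simp add: pair_def)
    have u0: "u None \<ge> 0" using u[of None] by auto
    have finC: "finite C" using C finite_I finite_subset by blast
    \<comment> \<open>Coefficients on \<open>C\<close> may be negative; \<open>N\<close> is large
      enough to compensate each of them.\<close>
    define N where "N = (\<Sum>i\<in>C. \<bar>u (Some i)\<bar>)"
    define b where "b i = (if i \<in> C then N else 0)" for i
    have "N \<ge> 0" by (simp add: N_def sum_nonneg)
    have N: "N + u (Some i) \<ge> 0" if "i \<in> C" for i
      using member_le_sum[of i C "\<lambda>i. \<bar>u (Some i)\<bar>"] that finC by (simp add: N_def)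
    let ?x = "\<Sum>i\<in>I. b i *\<^sub>R v i"
    have "\<forall>i\<in>I. b i + u (Some i) = b i"
    proof (rule coherent_decomposition_strictly_cheapest)
      show "decomposition ?x b" using \<open>N \<ge> 0\<close> by (auto simp: decomposition_def b_def)
      show "pairwise coh {i\<in>I. b i \<noteq> 0}"
        using C(3) by (rule pairwise_subset) (auto simp: b_def split: if_splits)
      show "decomposition ?x (\<lambda>i. b i + u (Some i))"
        using N u flow by (auto simp: decomposition_def b_def scaleR_add_left sum.distrib)
      show "(\<Sum>i\<in>I. (b i + u (Some i)) * h i) \<le> (\<Sum>i\<in>I. b i * h i)"
        using height u0 by (simp add: distrib_right sum.distrib)
    qed
    then have "\<forall>i\<in>I. u (Some i) = 0" by simp
    moreover from this have "u None = 0" using height by simp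
    ultimately show "\<forall>k\<in>insert None (Some ` I) - Some ` C. u k = 0" by auto
  qed
  then obtain p where p: "\<forall>k\<in>Some ` C. f k p = 0" "\<forall>k\<in>insert None (Some ` I) - Some ` C. f k p > 0"
    by blast
  define w t where "w = fst p" "t = snd p"
  have t: "t > 0" using bspec[OF p(2), of None] by (auto simp: f_def w_t_def)
  define \<phi> where "\<phi> x = pair w x / t" for x
  have "linear \<phi>"
    by (rule linearI)
       (simp_all only: \<phi>_def pair_def lookup_add lookup_scaleR real_scaleR_def distrib_left
          sum.distrib add_divide_distrib sum_distrib_left mult.left_commute times_divide_eq_right)
  moreover have zero: "\<phi> (v i) + h i = 0" if "i \<in> C" for i
    using p(1) that t by (auto simp: f_def w_t_def \<phi>_def field_simps)
  moreover have pos: "\<phi> (v i) + h i > 0" if "i \<in> I - C" for i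
  proof -
    have "pair w (v i) + t * h i > 0" using bspec[OF p(2), of "Some i"] that by (auto simp: f_def w_t_def)
    then show ?thesis using t by (auto simp: \<phi>_def field_simps)
  qed
  have "{i\<in>I. \<forall>j\<in>I. \<phi> (v i) + h i \<le> \<phi> (v j) + h j} = C"
  proof (intro equalityI subsetI)
    fix i assume i: "i \<in> {i\<in>I. \<forall>j\<in>I. \<phi> (v i) + h i \<le> \<phi> (v j) + h j}"
    obtain j where "j \<in> C" using C by auto
    then have "\<phi> (v i) + h i \<le> 0" using i zero[of j] C by force
    then show "i \<in> C" using pos[of i] i by force
  next
    fix i assume i: "i \<in> C"
    have "\<phi> (v j) + h j \<ge> 0" if "j \<in> I" for j
      using zero[of j] pos[of j] that by (cases "j \<in> C") auto
    then show "i \<in> {i\<in>I. \<forall>j\<in>I. \<phi> (v i) + h i \<le> \<phi> (v j) + h j}"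
      using i zero C by auto
  qed
  ultimately show ?thesis by blast
qed

theorem lower_faces_eq_coherent_sets:
  "{fst ` F | F. lower_face F (convex hull ((\<lambda>i. (v i, h i)) ` I))} =
   {convex hull (v ` C) | C. C \<subseteq> I \<and> C \<noteq> {} \<and> pairwise coh C}"
proof -
  let ?M = "\<lambda>\<phi>. {i\<in>I. \<forall>j\<in>I. \<phi> (v i) + h i \<le> \<phi> (v j) + h j}"
  let ?L = "convex hull ((\<lambda>i. (v i, h i)) ` I)"
  let ?F = "\<lambda>\<phi>. {(x, z) \<in> ?L. \<forall>(y, w) \<in> ?L. \<phi> x + z \<le> \<phi> y + w}"
  have M: "fst ` ?F \<phi> = convex hull (v ` ?M \<phi>)" if "linear \<phi>" "I \<noteq> {}" for \<phi>
    using fst_minimal_face[OF finite_I that] .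
  have coh: "pairwise coh (?M \<phi>)" if phi: "linear \<phi>" for \<phi>
  proof (rule ccontr)
    assume "\<not> ?thesis"
    then obtain i j where ij: "i \<in> ?M \<phi>" "j \<in> ?M \<phi>" "i \<noteq> j" "\<not> coh i j"
      by (auto simp: pairwise_def)
    obtain i' j' where ij': "i' \<in> I" "j' \<in> I" "v i' + v j' = v i + v j" "h i' + h j' < h i + h j"
      using exchange[of i j] ij by auto
    have "\<phi> (v i') + \<phi> (v j') = \<phi> (v i) + \<phi> (v j)"
      using ij'(3) linear_add[OF phi] by metis
    moreover have "\<phi> (v i) + h i \<le> \<phi> (v i') + h i'" "\<phi> (v j) + h j \<le> \<phi> (v j') + h j'"
      using ij ij' by auto
    ultimately show False using ij'(4) by linarith
  qed
  show ?thesis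
  proof (intro equalityI subsetI)
    fix X assume "X \<in> {fst ` F | F. lower_face F ?L}"
    then obtain \<phi> where phi: "linear \<phi>" "X = fst ` ?F \<phi>" "?F \<phi> \<noteq> {}"
      by (auto simp: lower_face_def)
    have "I \<noteq> {}"
    proof
      assume "I = {}"
      then have "?L = {}" by simp
      with phi(3) show False by blast
    qed
    note X = M[OF phi(1) this]
    have "?M \<phi> \<noteq> {}"
    proof
      assume "?M \<phi> = {}"
      then have "fst ` ?F \<phi> = {}" unfolding X by simp
      with phi(3) show False by blast
    qed
    then show "X \<in> {convex hull (v ` C) | C. C \<subseteq> I \<and> C \<noteq> {} \<and> pairwise coh C}"
      using X phi(2) coh[OF phi(1)] by blast
  next
    fix X assume "X \<in> {convex hull (v ` C) | C. C \<subseteq> I \<and> C \<noteq> {} \<and> pairwise coh C}"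
    then obtain C where C: "C \<subseteq> I" "C \<noteq> {}" "pairwise coh C" "X = convex hull (v ` C)" by blast
    obtain \<phi> where phi: "linear \<phi>" "?M \<phi> = C" using coherent_set_supported[OF C(1-3)] by blast
    have X: "fst ` ?F \<phi> = X" using M[OF phi(1)] C phi(2) by auto
    have "X \<noteq> {}" using C by simp
    then have "?F \<phi> \<noteq> {}" using X by (metis image_empty)
    then have "lower_face (?F \<phi>) ?L" using phi(1) by (auto simp: lower_face_def)
    then show "X \<in> {fst ` F | F. lower_face F ?L}" using X by blast
  qed
qed

end

section \<open>Routes of the oruga graph\<close>

text \<open>Upper indices decrease by 1 along a route, so recursion on \<open>k\<close> makes every
  final segment of such a list again one of this form.\<close>

primrec path_edges :: "nat \<Rightarrow> (nat \<Rightarrow> nat) \<Rightarrow> (nat \<times> nat) list" where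
  "path_edges 0 x = []"
| "path_edges (Suc k) x = (Suc k, x (Suc k)) # path_edges k x"

lemma path_edges_conv_map: "path_edges k x = map (\<lambda>c. (c, x c)) (rev [1..<Suc k])"
  by (induction k) auto

lemma set_path_edges: "set (path_edges k x) = (\<lambda>c. (c, x c)) ` {1..k}"
  by (auto simp: path_edges_conv_map)

lemma mem_set_path_edges: "(c, j) \<in> set (path_edges k x) \<longleftrightarrow> c \<in> {1..k} \<and> j = x c"
  by (auto simp: set_path_edges)

lemma path_edges_cong: "(\<And>c. c \<in> {1..k} \<Longrightarrow> x c = y c) \<Longrightarrow> path_edges k x = path_edges k y"
  by (auto simp: path_edges_conv_map)

lemma path_edges_split:
  "b \<le> k \<Longrightarrow> path_edges k x = map (\<lambda>c. (c, x c)) (rev [Suc b..<Suc k]) @ path_edges b x"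
  by (induction k rule: dec_induct) auto

lemma path_edges_eq_append_Cons:
  "path_edges k x = P @ e # R \<Longrightarrow> \<exists>c. Suc c \<le> k \<and> e = (Suc c, x (Suc c)) \<and> R = path_edges c x"
proof (induction k arbitrary: P)
  case (Suc k)
  then show ?case by (cases P) (auto intro: le_SucI)
qed simp

lemma path_edges_common_prefix:
  "path_edges k x = M @ f # P \<Longrightarrow> path_edges k y = M @ f' # Q \<Longrightarrow>
   \<exists>b\<in>{1..k}. f = (b, x b) \<and> f' = (b, y b) \<and> (\<forall>d\<in>{b<..k}. x d = y d)"
proof (induction k arbitrary: M)
  case (Suc k)
  show ?case
  proof (cases M)
    case Nil
    then show ?thesis using Suc.prems by (intro bexI[of _ "Suc k"]) auto
  next
    case (Cons a M')
    then obtain b where "b \<in> {1..k}" "f = (b, x b)" "f' = (b, y b)" "\<forall>d\<in>{b<..k}. x d = y d"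
      using Suc.IH[of M'] Suc.prems by auto
    moreover have "x (Suc k) = y (Suc k)" using Cons Suc.prems by auto
    ultimately show ?thesis by (intro bexI[of _ b]) (auto simp: le_Suc_eq)
  qed
qed simp

text \<open>
  In \<open>(k, x)\<close>, the values \<open>x c\<close> are the numbers \<open>t\<^sub>c\<close> of the paper; outside \<open>{1..k}\<close> they are
  normalised to \<open>0\<close> so that a route has only one code.
\<close>

definition codes :: "(nat \<Rightarrow> nat) \<Rightarrow> nat \<Rightarrow> (nat \<times> (nat \<Rightarrow> nat)) set" where
  "codes s n = {(k, x). k \<in> {1..n+1} \<and> 0 < x k \<and> x k < s k \<and>
     (\<forall>c\<in>{1..<k}. x c \<in> {0, s c}) \<and> (\<forall>c. c \<notin> {1..k} \<longrightarrow> x c = 0)}"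

abbreviation decode :: "nat \<times> (nat \<Rightarrow> nat) \<Rightarrow> (nat \<times> nat) list" where
  "decode r \<equiv> path_edges (fst r) (snd r)"

lemma codesD:
  assumes "r \<in> codes s n"
  shows "fst r \<in> {1..n+1}" "0 < snd r (fst r)" "snd r (fst r) < s (fst r)"
    "\<And>c. 1 \<le> c \<Longrightarrow> c < fst r \<Longrightarrow> snd r c = 0 \<or> snd r c = s c"
    "\<And>c. fst r < c \<Longrightarrow> snd r c = 0" "snd r 0 = 0"
  using assms by (auto simp: codes_def)

lemma codes_le: "r \<in> codes s n \<Longrightarrow> snd r c \<le> s c"
  by (cases "c \<in> {1..<fst r}"; cases "c = fst r") (auto simp: codes_def dest!: bspec[where x = c])

lemma finite_codes: "finite (codes s n)"
proof -
  define m where "m = (\<Sum>c\<in>{1..n+1}. s c)"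
  have m: "s c \<le> m" if "c \<in> {1..n+1}" for c
    unfolding m_def using that by (intro member_le_sum) auto
  have "x c \<le> m" if "(k, x) \<in> codes s n" "c \<in> {1..n+1}" for k x c
    using codes_le[OF that(1), of c] m[OF that(2)] by simp
  then have "codes s n \<subseteq> {1..n+1} \<times>
      {x. \<forall>c. (c \<in> {1..n+1} \<longrightarrow> x c \<in> {..m}) \<and> (c \<notin> {1..n+1} \<longrightarrow> x c = 0)}"
    by (fastforce simp: codes_def)
  moreover have "finite {x :: nat \<Rightarrow> nat. \<forall>c. (c \<in> {1..n+1} \<longrightarrow> x c \<in> {..m}) \<and> (c \<notin> {1..n+1} \<longrightarrow> x c = 0)}"
    by (rule finite_set_of_finite_funs) auto
  ultimately show ?thesis
    by (meson finite_SigmaI finite_atLeastAtMost finite_subset)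
qed

lemma inj_on_decode: "inj_on decode (codes s n)"
proof (rule inj_onI)
  fix r q assume r: "r \<in> codes s n" and q: "q \<in> codes s n" and eq: "decode r = decode q"
  have "length (decode r) = fst r" for r :: "nat \<times> (nat \<Rightarrow> nat)"
    by (simp add: path_edges_conv_map)
  then have k: "fst r = fst q" using eq by metis
  have "snd r c = snd q c" for c
  proof (cases "c \<in> {1..fst r}")
    case True
    then have "(c, snd r c) \<in> set (decode q)" by (auto simp: set_path_edges simp flip: eq)
    then show ?thesis by (auto simp: set_path_edges)
  next
    case False
    then show ?thesis using r q k by (auto simp: codes_def)
  qed
  then show "r = q" using k by (auto simp: prod_eq_iff)
qed

text \<open>For \<open>i \<ge> 1\<close>, only the bump and the dip with upper index
  \<open>i\<close> leave the vertex \<open>n - i\<close>, and both lead to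
  \<open>n - (i - 1)\<close>; no arc leaves the vertex \<open>n\<close>.\<close>

lemma walk_from_inner_vertex:
  assumes "set p \<subseteq> arcs (oruga s n)" "pre_digraph.cas (oruga s n) (int n - int i) p (int n)" "i \<le> n"
  shows "\<exists>x. p = path_edges i x \<and> (\<forall>c\<in>{1..i}. x c \<in> {0, s c})"
  using assms
proof (induction i arbitrary: p)
  case 0
  have "p = []"
  proof (cases p)
    case (Cons e es)
    then have "tail (oruga s n) e = int n" "e \<in> arcs (oruga s n)"
      using 0 by (auto simp: pre_digraph.cas.simps)
    then show ?thesis by (auto simp: oruga_def split: if_splits)
  qed
  then show ?case by simp
next
  case (Suc i)
  obtain a b es where p: "p = (a, b) # es"
    using Suc.prems(2) by (cases p) (auto simp: pre_digraph.cas.simps)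
  have t: "tail (oruga s n) (a, b) = int n - int (Suc i)" and ab: "(a, b) \<in> arcs (oruga s n)"
    and es: "pre_digraph.cas (oruga s n) (head (oruga s n) (a, b)) es (int n)" "set es \<subseteq> arcs (oruga s n)"
    using Suc.prems p by (auto simp: pre_digraph.cas.simps)
  have a: "a = Suc i" "b \<in> {0, s a}"
    using t ab Suc.prems(3) by (auto simp: oruga_def split: if_splits)
  have "head (oruga s n) (a, b) = int n - int i" using a by (simp add: oruga_def)
  then obtain x where x: "es = path_edges i x" "\<forall>c\<in>{1..i}. x c \<in> {0, s c}"
    using Suc.IH[of es] es Suc.prems(3) by auto
  define y where "y = x(Suc i := b)"
  have "path_edges i x = path_edges i y"
    by (rule path_edges_cong) (simp add: y_def)
  then have "p = path_edges (Suc i) y" using x p a by (simp add: y_def)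
  moreover have "\<forall>c\<in>{1..Suc i}. y c \<in> {0, s c}"
    using x a by (auto simp: y_def)
  ultimately show ?case by blast
qed

lemma cas_path_edges:
  assumes "\<forall>c\<in>{1..i}. x c \<notin> {1..<s c}"
  shows "pre_digraph.cas (oruga s n) (int n - int i) (path_edges i x) (int n)"
  using assms
proof (induction i)
  case (Suc i)
  have "tail (oruga s n) (Suc i, x (Suc i)) = int n - int (Suc i)"
    using bspec[OF Suc.prems, of "Suc i"] by (auto simp: oruga_def)
  moreover have "head (oruga s n) (Suc i, x (Suc i)) = int n - int i"
    by (simp add: oruga_def)
  ultimately show ?case
    using Suc by (simp add: pre_digraph.cas.simps)
qed (simp add: pre_digraph.cas.simps)

text \<open>Bumps and dips have upper index at most \<open>n\<close>, so an arc leaving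
  \<open>-1\<close> is a source edge; from its head on, \<open>walk_from_inner_vertex\<close>
  applies. Conversely, the vertices of a decoded code increase, so the walk repeats none of
  them.\<close>

lemma routes_eq_decode:
  assumes s: "\<And>i. i \<in> {1..n} \<Longrightarrow> s i \<ge> 1"
  shows "routes s n = decode ` codes s n"
proof (intro equalityI subsetI)
  fix p assume "p \<in> routes s n"
  then have arcs: "set p \<subseteq> arcs (oruga s n)" and cas: "pre_digraph.cas (oruga s n) (- 1) p (int n)"
    by (auto simp: routes_def pre_digraph.apath_def pre_digraph.awalk_def)
  obtain a b es where p: "p = (a, b) # es"
    using cas by (cases p) (auto simp: pre_digraph.cas.simps)
  have t: "tail (oruga s n) (a, b) = - 1" and ab: "(a, b) \<in> arcs (oruga s n)"
    and es: "pre_digraph.cas (oruga s n) (head (oruga s n) (a, b)) es (int n)" "set es \<subseteq> arcs (oruga s n)"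
    using arcs cas p by (auto simp: pre_digraph.cas.simps)
  have a: "a \<in> {1..n+1}" "b \<in> {1..<s a}"
    using t ab by (auto simp: oruga_def split: if_splits)
  have "head (oruga s n) (a, b) = int n - int (a - 1)" using a by (auto simp: oruga_def)
  then obtain x where x: "es = path_edges (a - 1) x" "\<forall>c\<in>{1..a-1}. x c \<in> {0, s c}"
    using walk_from_inner_vertex[of es s n "a - 1"] es a(1) by (metis One_nat_def atLeastAtMost_iff
      le_diff_conv)
  define y where "y c = (if c = a then b else if c \<in> {1..<a} then x c else 0)" for c
  have "path_edges (a - 1) x = path_edges (a - 1) y"
    using a by (intro path_edges_cong) (auto simp: y_def)
  moreover have "path_edges a y = (a, b) # path_edges (a - 1) y"
    using a by (cases a) (auto simp: y_def)
  ultimately have "p = decode (a, y)" using p x by simp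
  moreover have "(a, y) \<in> codes s n" using a x by (auto simp: codes_def y_def)
  ultimately show "p \<in> decode ` codes s n" by blast
next
  fix p assume "p \<in> decode ` codes s n"
  then obtain k x where kx: "(k, x) \<in> codes s n" and p: "p = path_edges k x" by auto
  have k: "k \<in> {1..n+1}" "0 < x k" "x k < s k" "\<forall>c\<in>{1..<k}. x c \<in> {0, s c}"
    using kx by (auto simp: codes_def)
  obtain i where i: "k = Suc i" using k(1) by (cases k) auto
  have arcs: "set p \<subseteq> arcs (oruga s n)"
  proof
    fix e assume "e \<in> set p"
    then obtain c where c: "c \<in> {1..k}" "e = (c, x c)" by (auto simp: p set_path_edges)
    show "e \<in> arcs (oruga s n)"
      using k c by (cases "c = k") (auto simp: oruga_def)
  qed
  have "\<forall>c\<in>{1..i}. x c \<notin> {1..<s c}"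
  proof
    fix c assume "c \<in> {1..i}"
    then have "x c \<in> {0, s c}" using k(4) i by auto
    then show "x c \<notin> {1..<s c}" by auto
  qed
  from cas_path_edges[OF this, of n]
  have cas: "pre_digraph.cas (oruga s n) (- 1) p (int n)"
    using k i by (simp add: p pre_digraph.cas.simps oruga_def)
  have heads: "map (head (oruga s n)) p = map (\<lambda>c. int n + 1 - int c) (rev [1..<Suc k])"
    by (simp add: p path_edges_conv_map oruga_def)
  have "p \<noteq> []" by (simp add: p i)
  then have "pre_digraph.awalk_verts (oruga s n) (- 1) p = tail (oruga s n) (hd p) # map (head (oruga s n)) p"
    using pre_digraph.awalk_verts_conv'[OF cas] by simp
  moreover have "tail (oruga s n) (hd p) = - 1" using k i by (simp add: p oruga_def)
  moreover have "distinct (map (head (oruga s n)) p)" "- 1 \<notin> set (map (head (oruga s n)) p)"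
    unfolding heads using k by (auto simp: distinct_map inj_on_def)
  ultimately have "distinct (pre_digraph.awalk_verts (oruga s n) (- 1) p)" by simp
  then show "p \<in> routes s n"
    using arcs cas by (auto simp: routes_def pre_digraph.apath_def pre_digraph.awalk_def oruga_def)
qed

text \<open>
  \<open>enters_below b r q\<close>: the common subpath of \<open>r\<close> and \<open>q\<close> that leads to the tail of their edges
  with upper index \<open>b\<close> is entered by \<open>r\<close> through a smaller edge.
\<close>

definition enters_below :: "nat \<Rightarrow> nat \<times> (nat \<Rightarrow> nat) \<Rightarrow> nat \<times> (nat \<Rightarrow> nat) \<Rightarrow> bool" where
  "enters_below b r q \<longleftrightarrow> (\<exists>c. b < c \<and> c \<le> fst r \<and> c \<le> fst q \<and> snd r c < snd q c \<and>
     (\<forall>d\<in>{b<..<c}. snd r d = snd q d))"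

text \<open>One orientation of a conflict: two routes are incoherent iff they cross in this order or
  in the reverse one, as the next lemmas show.\<close>

definition crossing :: "nat \<times> (nat \<Rightarrow> nat) \<Rightarrow> nat \<times> (nat \<Rightarrow> nat) \<Rightarrow> bool" where
  "crossing r q \<longleftrightarrow> (\<exists>b\<ge>1. enters_below b r q \<and> snd q b < snd r b)"

lemma coherentD:
  "coherent s n P Q \<Longrightarrow> P = P\<^sub>1 @ [e] @ M @ [f] @ P\<^sub>2 \<Longrightarrow> Q = Q\<^sub>1 @ [e'] @ M @ [f'] @ Q\<^sub>2 \<Longrightarrow>
   head (oruga s n) e = head (oruga s n) e' \<Longrightarrow> e \<noteq> e' \<Longrightarrow> f \<noteq> f' \<Longrightarrow>
   precedes e e' \<longleftrightarrow> precedes f f'"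
  unfolding coherent_def by blast

lemma not_coherent_if_crossing:
  assumes "crossing r q"
  shows "\<not> coherent s n (decode r) (decode q)" "\<not> coherent s n (decode q) (decode r)"
proof -
  obtain b c where bc: "1 \<le> b" "b < c" "c \<le> fst r" "c \<le> fst q" "snd r c < snd q c"
      "snd q b < snd r b" "\<forall>d\<in>{b<..<c}. snd r d = snd q d"
    using assms by (auto simp: crossing_def enters_below_def)
  obtain b' c' where b': "b = Suc b'" "c = Suc c'" using bc by (metis Suc_le_D less_imp_Suc_add add_Suc_right One_nat_def)
  \<comment> \<open>The common part, with upper indices strictly between \<open>b\<close> and
    \<open>c\<close>; it is empty if \<open>c = b + 1\<close>.\<close>
  define M where "M x = map (\<lambda>c. (c, x c :: nat)) (rev [Suc b..<Suc c'])" for x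
  have split: "path_edges k x = map (\<lambda>c. (c, x c)) (rev [Suc c..<Suc k]) @ [(c, x c)] @ M x @
      [(b, x b)] @ path_edges b' x" if "c \<le> k" for k x
    using path_edges_split[OF that, of x] path_edges_split[of b c' x] bc b' by (simp add: M_def)
  have M: "M (snd r) = M (snd q)" using bc b' by (auto simp: M_def)
  note splits = split[OF bc(3), of "snd r"] split[OF bc(4), of "snd q", folded M]
  have head: "head (oruga s n) (c, i) = head (oruga s n) (c, j)" for i j by (simp add: oruga_def)
  show "\<not> coherent s n (decode r) (decode q)"
    using coherentD[OF _ splits head] bc(5,6) by (auto simp: precedes_def)
  show "\<not> coherent s n (decode q) (decode r)"
    using coherentD[OF _ splits(2,1) head] bc(5,6) by (auto simp: precedes_def)
qed

lemma crossing_if_not_coherent: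
  assumes "\<not> coherent s n (decode r) (decode q)"
  shows "crossing r q \<or> crossing q r"
proof -
  obtain M P1 e f P2 Q1 e' f' Q2 where
    P': "decode r = P1 @ [e] @ M @ [f] @ P2" and Q': "decode q = Q1 @ [e'] @ M @ [f'] @ Q2" and
    h: "head (oruga s n) e = head (oruga s n) e'" and ne: "e \<noteq> e'" "f \<noteq> f'" and
    pr: "precedes e e' \<noteq> precedes f f'"
    using assms unfolding coherent_def by blast
  have P: "decode r = P1 @ e # (M @ f # P2)" and Q: "decode q = Q1 @ e' # (M @ f' # Q2)"
    using P' Q' by simp_all
  obtain c where c: "Suc c \<le> fst r" "e = (Suc c, snd r (Suc c))" "M @ f # P2 = path_edges c (snd r)"
    using path_edges_eq_append_Cons[OF P] by auto
  obtain c' where c': "Suc c' \<le> fst q" "e' = (Suc c', snd q (Suc c'))" "M @ f' # Q2 = path_edges c' (snd q)"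
    using path_edges_eq_append_Cons[OF Q] by auto
  \<comment> \<open>The head of an edge determines its upper index.\<close>
  have "c' = c" using h c(2) c'(2) by (simp add: oruga_def)
  note c' = c'[unfolded this]
  obtain b where b: "b \<in> {1..c}" "f = (b, snd r b)" "f' = (b, snd q b)"
      "\<forall>d\<in>{b<..c}. snd r d = snd q d"
    using path_edges_common_prefix[OF c(3)[symmetric] c'(3)[symmetric]] by auto
  have "enters_below b r q" if "snd r (Suc c) < snd q (Suc c)"
    unfolding enters_below_def using that b c c' by (intro exI[of _ "Suc c"]) auto
  moreover have "enters_below b q r" if "snd q (Suc c) < snd r (Suc c)"
    unfolding enters_below_def using that b c c' by (intro exI[of _ "Suc c"]) auto
  moreover have "snd r (Suc c) < snd q (Suc c) \<and> snd q b < snd r b \<or>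
      snd q (Suc c) < snd r (Suc c) \<and> snd r b < snd q b"
    using pr ne b c c' by (auto simp: precedes_def)
  ultimately show ?thesis using b(1) by (auto simp: crossing_def)
qed

lemma lookup_indicator_vector:
  "Poly_Mapping.lookup (indicator_vector P) e = (if e \<in> set P then 1 else 0)"
  by (simp add: indicator_vector_def lookup_sum lookup_single when_def)

section \<open>Uniqueness of coherent decompositions\<close>

text \<open>For \<open>i \<le> fst r\<close> this remembers the initial part of the route, up to its
  arrival at the vertex \<open>n + 1 - i\<close>.\<close>

definition truncate_code :: "nat \<Rightarrow> nat \<times> (nat \<Rightarrow> nat) \<Rightarrow> nat \<times> (nat \<Rightarrow> nat)" where
  "truncate_code i r = (fst r, \<lambda>c. if i \<le> c then snd r c else 0)"

lemma truncate_eq_iff: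
  "truncate_code i r = truncate_code i q \<longleftrightarrow> fst r = fst q \<and> (\<forall>c\<ge>i. snd r c = snd q c)"
  by (auto simp: truncate_code_def fun_eq_iff)

lemma enters_below_truncate_left:
  "truncate_code (Suc i) r = truncate_code (Suc i) r' \<Longrightarrow> enters_below i r q \<longleftrightarrow> enters_below i r' q"
  unfolding enters_below_def truncate_eq_iff by (auto intro!: ex_cong)

lemma enters_below_truncate_right:
  "truncate_code (Suc i) q = truncate_code (Suc i) q' \<Longrightarrow> enters_below i r q \<longleftrightarrow> enters_below i r q'"
  unfolding enters_below_def truncate_eq_iff by (auto intro!: ex_cong)

lemma not_enters_below_if_truncate_eq:
  "truncate_code (Suc i) r = truncate_code (Suc i) q \<Longrightarrow> \<not> enters_below i r q"
  by (auto simp: enters_below_def truncate_eq_iff)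

text \<open>The least index above \<open>i\<close> at which the routes differ decides the order. If
  they agree at all common indices, they also start alike: the lower index of a source edge lies
  strictly between 0 and \<open>s\<close>, while a longer route has a bump or a dip at that
  position.\<close>

lemma enters_below_cases:
  assumes r: "r \<in> codes s n" "i < fst r" and q: "q \<in> codes s n" "i < fst q"
  shows "enters_below i r q \<or> truncate_code (Suc i) r = truncate_code (Suc i) q \<or> enters_below i q r"
proof (cases "\<exists>c>i. c \<le> fst r \<and> c \<le> fst q \<and> snd r c \<noteq> snd q c")
  case True
  define c where "c = (LEAST c. i < c \<and> c \<le> fst r \<and> c \<le> fst q \<and> snd r c \<noteq> snd q c)"
  have c: "i < c \<and> c \<le> fst r \<and> c \<le> fst q \<and> snd r c \<noteq> snd q c"
    unfolding c_def using True by (rule LeastI_ex)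
  have "snd r d = snd q d" if "d \<in> {i<..<c}" for d
    using not_less_Least[of d "\<lambda>c. i < c \<and> c \<le> fst r \<and> c \<le> fst q \<and> snd r c \<noteq> snd q c"] that c
    by (auto simp: c_def[symmetric])
  then show ?thesis
    using c unfolding enters_below_def by (cases "snd r c < snd q c") (auto intro!: exI[of _ c])
next
  case False
  then have eq: "snd r c = snd q c" if "i < c" "c \<le> fst r" "c \<le> fst q" for c
    using that by blast
  have "fst r = fst q"
  proof (rule linorder_cases[of "fst r" "fst q"])
    assume "fst r < fst q"
    then show ?thesis
      using eq[of "fst r"] codesD(1-3)[OF r(1)] codesD(4)[OF q(1), of "fst r"] r by auto
  next
    assume "fst q < fst r"
    then show ?thesis
      using eq[of "fst q"] codesD(1-3)[OF q(1)] codesD(4)[OF r(1), of "fst q"] q by auto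
  qed
  moreover have "snd r c = snd q c" if "Suc i \<le> c" for c
    using eq[of c] codesD(5)[OF r(1), of c] codesD(5)[OF q(1), of c] that calculation
    by (cases "c \<le> fst r") auto
  ultimately show ?thesis by (auto simp: truncate_eq_iff)
qed

lemma truncate_one_inj:
  assumes "r \<in> codes s n" "q \<in> codes s n" "truncate_code 1 r = truncate_code 1 q"
  shows "r = q"
proof -
  have "snd r c = snd q c" for c
    using assms codesD(6)[OF assms(1)] codesD(6)[OF assms(2)]
    by (cases c) (auto simp: truncate_eq_iff)
  moreover have "fst r = fst q" using assms(3) by (simp add: truncate_eq_iff)
  ultimately show ?thesis by (simp add: prod_eq_iff fun_eq_iff)
qed

definition prefix_class :: "(nat \<Rightarrow> nat) \<Rightarrow> nat \<Rightarrow> nat \<Rightarrow> nat \<times> (nat \<Rightarrow> nat) \<Rightarrow> (nat \<times> (nat \<Rightarrow> nat)) set" where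
  "prefix_class s n i r = {q \<in> codes s n. truncate_code i q = truncate_code i r}"

text \<open>
  At a vertex, the routes of a family without crossings are ordered by the way they enter, and those
  leaving through the bump come before those leaving through the dip. Hence, if \<open>u\<close> sends more of a
  prefix class through the bump than \<open>w\<close>, then it sends at least as much of everything
  before and of everything after the class through the bump as well, contradicting the equal flows.
\<close>

lemma bump_mass_le:
  fixes u w :: "nat \<times> (nat \<Rightarrow> nat) \<Rightarrow> real"
  assumes i: "1 \<le> i" "s i > 0"
    and r: "r \<in> codes s n" "i < fst r"
    and u: "\<And>q. q \<in> codes s n \<Longrightarrow> u q \<ge> 0" and w: "\<And>q. q \<in> codes s n \<Longrightarrow> w q \<ge> 0"
    and ucross: "\<And>q p. q \<in> codes s n \<Longrightarrow> p \<in> codes s n \<Longrightarrow> u q \<noteq> 0 \<Longrightarrow> u p \<noteq> 0 \<Longrightarrow> \<not> crossing q p"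
    and wcross: "\<And>q p. q \<in> codes s n \<Longrightarrow> p \<in> codes s n \<Longrightarrow> w q \<noteq> 0 \<Longrightarrow> w p \<noteq> 0 \<Longrightarrow> \<not> crossing q p"
    and flow: "sum u {q\<in>codes s n. (i, 0) \<in> set (decode q)} = sum w {q\<in>codes s n. (i, 0) \<in> set (decode q)}"
    and IH: "\<And>q. q \<in> codes s n \<Longrightarrow> i < fst q \<Longrightarrow>
      sum u (prefix_class s n (Suc i) q) = sum w (prefix_class s n (Suc i) q)"
  shows "sum u {q \<in> prefix_class s n (Suc i) r. snd q i = 0} \<le> sum w {q \<in> prefix_class s n (Suc i) r. snd q i = 0}"
proof (rule ccontr)
  let ?K = "codes s n" and ?A = "prefix_class s n (Suc i) r"
  let ?B = "{q \<in> ?A. snd q i = 0}" and ?D = "{q \<in> ?A. snd q i \<noteq> 0}"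
  assume neg: "\<not> ?thesis"
  define J where "J = {q \<in> ?K. i < fst q}"
  define Lt where "Lt = {q \<in> J. enters_below i q r}"
  define Gt where "Gt = J - Lt - ?A"
  have finK: "finite ?K" by (rule finite_codes)
  have AK: "?A \<subseteq> ?K" by (auto simp: prefix_class_def)
  have fin: "finite ?A" "finite J" "finite Lt" "finite Gt"
    using finK finite_subset[OF AK finK] by (auto simp: J_def Lt_def Gt_def)
  have AJ: "?A \<subseteq> J" using r by (auto simp: prefix_class_def J_def truncate_eq_iff)
  have disj: "Lt \<inter> ?A = {}"
    using not_enters_below_if_truncate_eq[of i _ r] by (fastforce simp: Lt_def prefix_class_def)
  have Gt: "enters_below i r q" if "q \<in> Gt" for q
    using enters_below_cases[OF _ _ r, of q] that by (auto simp: Gt_def Lt_def J_def prefix_class_def)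
  have split: "sum f ?A = sum f ?B + sum f ?D" for f :: "_ \<Rightarrow> real"
  proof -
    have "?A = ?B \<union> ?D" by auto
    then show ?thesis using fin(1) by (metis (no_types, lifting) sum.union_disjoint finite_Un
      disjoint_iff mem_Collect_eq)
  qed
  have u0: "sum u ?B > 0"
    using neg sum_nonneg[of ?B w] w AK by fastforce
  \<comment> \<open>Both weightings give the class the same mass, so an excess of \<open>u\<close>
    on the bump leaves \<open>w\<close> positive mass on the dip. Then \<open>r0\<close> forces all
    \<open>u\<close>-mass of \<open>Lt\<close> onto the bump, and \<open>r1\<close> forces all
    \<open>w\<close>-mass of \<open>Gt\<close> onto the dip.\<close>
  have "sum w ?D > 0"
    using neg IH[OF r] split[of u] split[of w] sum_nonneg[of ?D u] u AK by fastforce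
  with u0 obtain r0 r1 where r0: "r0 \<in> ?B" "u r0 \<noteq> 0" and r1: "r1 \<in> ?D" "w r1 \<noteq> 0"
    by (metis (no_types, lifting) less_irrefl sum.neutral)
  let ?Z = "{q. snd q i = 0}"
  have u_Lt: "u q = 0" if q: "q \<in> Lt" "snd q i \<noteq> 0" for q
  proof (rule ccontr)
    assume "u q \<noteq> 0"
    have "enters_below i q r0"
      using q(1) r0(1) enters_below_truncate_right[of i r r0 q]
      by (auto simp: Lt_def prefix_class_def)
    then have "crossing q r0" using q(2) r0(1) i(1) by (auto simp: crossing_def)
    with ucross[of q r0] \<open>u q \<noteq> 0\<close> r0 q(1) AK show False by (auto simp: Lt_def J_def)
  qed
  have w_Gt: "w q = 0" if q: "q \<in> Gt" "snd q i = 0" for q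
  proof (rule ccontr)
    assume "w q \<noteq> 0"
    have "enters_below i r1 q"
      using Gt[OF q(1)] r1(1) enters_below_truncate_left[of i r r1 q]
      by (auto simp: prefix_class_def)
    then have "crossing r1 q" using q(2) r1(1) i(1) by (auto simp: crossing_def)
    with wcross[of r1 q] \<open>w q \<noteq> 0\<close> r1 q(1) AK show False by (auto simp: Gt_def J_def)
  qed
  \<comment> \<open>\<open>Lt\<close> is a union of prefix classes, because entering below
    \<open>r\<close> depends only on edges with upper index above \<open>i\<close>;
    \<open>IH\<close> applies to each class.\<close>
  have "sum u Lt = sum w Lt"
  proof -
    have "sum u {q'\<in>Lt. truncate_code (Suc i) q' = y} = sum w {q'\<in>Lt. truncate_code (Suc i) q' = y}"
      if y: "y \<in> truncate_code (Suc i) ` Lt" for y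
    proof -
      obtain q where q: "q \<in> Lt" "y = truncate_code (Suc i) q" using y by blast
      have mem: "q' \<in> Lt" if "q' \<in> ?K" "truncate_code (Suc i) q' = truncate_code (Suc i) q" for q'
      proof -
        have "fst q' = fst q" using that(2) by (simp add: truncate_eq_iff)
        then show ?thesis
          using q(1) that(1) enters_below_truncate_left[OF that(2), of r] by (simp add: Lt_def J_def)
      qed
      have LtK: "Lt \<subseteq> ?K" by (auto simp: Lt_def J_def)
      have "{q'\<in>Lt. truncate_code (Suc i) q' = y} = prefix_class s n (Suc i) q"
        using mem LtK q(2) unfolding prefix_class_def by blast
      then show ?thesis using IH[of q] q by (auto simp: Lt_def J_def)
    qed
    then have "(\<Sum>y\<in>truncate_code (Suc i) ` Lt. sum u {q'\<in>Lt. truncate_code (Suc i) q' = y}) =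
        (\<Sum>y\<in>truncate_code (Suc i) ` Lt. sum w {q'\<in>Lt. truncate_code (Suc i) q' = y})"
      by (rule sum.cong[OF refl])
    then show ?thesis
      using sum.image_gen[OF fin(3), of u "truncate_code (Suc i)"]
        sum.image_gen[OF fin(3), of w "truncate_code (Suc i)"] by argo
  qed
  moreover have "sum u (Lt \<inter> ?Z) = sum u Lt"
    using fin u_Lt by (intro sum.mono_neutral_left) auto
  moreover have "sum w (Lt \<inter> ?Z) \<le> sum w Lt"
    using fin w by (intro sum_mono2) (auto simp: Lt_def J_def)
  moreover have "sum w (Gt \<inter> ?Z) = 0"
    using w_Gt by (intro sum.neutral) auto
  moreover have "sum u (Gt \<inter> ?Z) \<ge> 0"
    using u by (intro sum_nonneg) (auto simp: Gt_def J_def)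
  moreover have "sum f {q\<in>?K. (i, 0) \<in> set (decode q)} = sum f (Lt \<inter> ?Z) + sum f ?B + sum f (Gt \<inter> ?Z)"
    for f :: "_ \<Rightarrow> real"
  proof -
    \<comment> \<open>A source edge has positive lower index, so a route that starts with upper
      index \<open>i\<close> never uses the bump.\<close>
    have "(i, 0) \<in> set (decode q) \<longleftrightarrow> i < fst q \<and> snd q i = 0" if "q \<in> ?K" for q
    proof -
      have "fst q \<noteq> i" if "snd q i = 0" using codesD(2)[OF \<open>q \<in> ?K\<close>] that by auto
      then show ?thesis using i by (auto simp: set_path_edges)
    qed
    then have "{q\<in>?K. (i, 0) \<in> set (decode q)} = (Lt \<inter> ?Z \<union> ?B) \<union> Gt \<inter> ?Z"
      using AJ by (auto simp: Gt_def Lt_def J_def)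
    moreover have "sum f ((Lt \<inter> ?Z \<union> ?B) \<union> Gt \<inter> ?Z) = sum f (Lt \<inter> ?Z \<union> ?B) + sum f (Gt \<inter> ?Z)"
      using fin disj by (intro sum.union_disjoint) (auto simp: Gt_def)
    moreover have "sum f (Lt \<inter> ?Z \<union> ?B) = sum f (Lt \<inter> ?Z) + sum f ?B"
      using fin disj by (intro sum.union_disjoint) auto
    ultimately show ?thesis by simp
  qed
  ultimately show False using flow neg by simp
qed

text \<open>Prefix classes receive equal mass from \<open>u\<close> and \<open>w\<close>, by
  downward induction on \<open>i\<close>: there is nothing to show at \<open>n + 2\<close>, and the
  classes at 1 are singletons. A class whose routes start at \<open>i\<close> consists of all routes
  through one source edge, so the flow determines its mass. Any other class is the bump part or the
  dip part of a class at \<open>i + 1\<close>; the bump part is settled by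
  \<open>bump_mass_le\<close> in both directions, the dip part is the rest.\<close>

lemma noncrossing_decomposition_unique:
  fixes u w :: "nat \<times> (nat \<Rightarrow> nat) \<Rightarrow> real"
  assumes s: "\<And>i. i \<in> {1..n} \<Longrightarrow> s i \<ge> 1"
    and u: "\<And>q. q \<in> codes s n \<Longrightarrow> u q \<ge> 0" and w: "\<And>q. q \<in> codes s n \<Longrightarrow> w q \<ge> 0"
    and ucross: "\<And>q p. q \<in> codes s n \<Longrightarrow> p \<in> codes s n \<Longrightarrow> u q \<noteq> 0 \<Longrightarrow> u p \<noteq> 0 \<Longrightarrow> \<not> crossing q p"
    and wcross: "\<And>q p. q \<in> codes s n \<Longrightarrow> p \<in> codes s n \<Longrightarrow> w q \<noteq> 0 \<Longrightarrow> w p \<noteq> 0 \<Longrightarrow> \<not> crossing q p"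
    and flow: "\<And>e. sum u {q\<in>codes s n. e \<in> set (decode q)} = sum w {q\<in>codes s n. e \<in> set (decode q)}"
    and r: "r \<in> codes s n"
  shows "u r = w r"
proof -
  have "1 \<le> n + 2" by simp
  then have "\<forall>r\<in>codes s n. 1 \<le> fst r \<longrightarrow> sum u (prefix_class s n 1 r) = sum w (prefix_class s n 1 r)"
  proof (induction rule: inc_induct)
    case base
    show ?case using codesD(1) by fastforce
  next
    case (step i)
    show ?case
    proof (intro ballI impI)
      fix r assume r: "r \<in> codes s n" and i: "i \<le> fst r"
      show "sum u (prefix_class s n i r) = sum w (prefix_class s n i r)"
      proof (cases "fst r = i")
        case True
        have "prefix_class s n i r = {q\<in>codes s n. (i, snd r i) \<in> set (decode q)}"
        proof (intro equalityI subsetI)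
          fix q assume "q \<in> prefix_class s n i r"
          then show "q \<in> {q\<in>codes s n. (i, snd r i) \<in> set (decode q)}"
            using True step(1) by (auto simp: prefix_class_def truncate_eq_iff set_path_edges)
        next
          fix q assume "q \<in> {q\<in>codes s n. (i, snd r i) \<in> set (decode q)}"
          then have q: "q \<in> codes s n" "i \<le> fst q" "snd q i = snd r i"
            by (auto simp: set_path_edges)
          have "\<not> i < fst q"
            using codesD(4)[OF q(1), of i] codesD(2,3)[OF r] True step(1) q(3) by auto
          then have "fst q = i" using q(2) by simp
          moreover have "snd q c = snd r c" if "c \<ge> i" for c
            using that codesD(5)[OF q(1), of c] codesD(5)[OF r, of c] True calculation q(3)
            by (cases "c = i") auto
          ultimately show "q \<in> prefix_class s n i r"
            using q True by (auto simp: prefix_class_def truncate_eq_iff)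
        qed
        then show ?thesis using flow by simp
      next
        case False
        then have ir: "i < fst r" using i by simp
        then have si: "s i > 0" "i \<in> {1..n}" using s[of i] codesD(1)[OF r] step(1) by auto
        let ?A = "prefix_class s n (Suc i) r"
        have IH: "sum u (prefix_class s n (Suc i) q) = sum w (prefix_class s n (Suc i) q)"
          if "q \<in> codes s n" "i < fst q" for q
          using step.IH that by auto
        have zero: "sum u {q \<in> ?A. snd q i = 0} = sum w {q \<in> ?A. snd q i = 0}"
          by (intro antisym bump_mass_le[OF step(1) si(1) r ir])
             (use u w ucross wcross flow IH in auto)
        have "finite ?A" using finite_codes by (auto simp: prefix_class_def)
        then have split: "sum f {q \<in> ?A. snd q i \<noteq> 0} = sum f ?A - sum f {q \<in> ?A. snd q i = 0}"
          for f :: "_ \<Rightarrow> real"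
          by (subst sum_diff[symmetric]) (auto intro!: sum.cong)
        have two: "snd q i = 0 \<or> snd q i = s i" if "q \<in> ?A" for q
          using that codesD(4)[of q s n i] ir step(1) by (auto simp: prefix_class_def truncate_eq_iff)
        have cls: "prefix_class s n i r = {q \<in> ?A. snd q i = snd r i}"
          by (auto simp: prefix_class_def truncate_eq_iff) (metis le_antisym not_less_eq_eq)
        have "r \<in> ?A" using r by (simp add: prefix_class_def)
        show ?thesis
        proof (cases "snd r i = 0")
          case True
          then show ?thesis using cls zero by simp
        next
          case False
          then have "{q \<in> ?A. snd q i = snd r i} = {q \<in> ?A. snd q i \<noteq> 0}"
            using two \<open>r \<in> ?A\<close> by metis
          then show ?thesis unfolding cls using split zero IH[OF r ir] by simp
        qed
      qed
    qed
  qed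
  moreover have "prefix_class s n 1 r = {r}"
    using truncate_one_inj[OF _ r] r unfolding prefix_class_def by blast
  ultimately show ?thesis using r codesD(1)[OF r] by auto
qed

section \<open>The height function\<close>

text \<open>This is \<delta>_a, recovered from the code. It has this meaning for \<open>a\<close>
  below the first index of the route, the only case that enters the height.\<close>

definition dip :: "(nat \<Rightarrow> nat) \<Rightarrow> nat \<Rightarrow> real" where
  "dip x a = (if x a = 0 then 0 else 1)"

text \<open>The cutoff lets routes of different lengths be summed over one common range and compared
  term by term.\<close>

definition height_term :: "real \<Rightarrow> nat \<times> (nat \<Rightarrow> nat) \<Rightarrow> nat \<Rightarrow> nat \<Rightarrow> real" where
  "height_term \<epsilon> r d a = (if d \<le> fst r then \<epsilon> ^ (d - a) * (real (snd r d) + dip (snd r) a)\<^sup>2 else 0)"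

definition code_height :: "real \<Rightarrow> nat \<Rightarrow> nat \<times> (nat \<Rightarrow> nat) \<Rightarrow> real" where
  "code_height \<epsilon> n r = - (\<Sum>d=1..n+1. \<Sum>a=1..<d. height_term \<epsilon> r d a)"

definition swap_below :: "nat \<Rightarrow> nat \<times> (nat \<Rightarrow> nat) \<Rightarrow> nat \<times> (nat \<Rightarrow> nat) \<Rightarrow> nat \<times> (nat \<Rightarrow> nat)" where
  "swap_below b r q = (fst r, \<lambda>a. if a \<le> b then snd q a else snd r a)"

lemma swap_below_mem_codes:
  assumes "r \<in> codes s n" "q \<in> codes s n" "b < fst r" "b < fst q"
  shows "swap_below b r q \<in> codes s n"
  using assms by (auto simp: codes_def swap_below_def)

lemma indicator_vector_swap_below:
  assumes "b < fst r" "b < fst q"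
  shows "indicator_vector (decode (swap_below b r q)) + indicator_vector (decode (swap_below b q r)) =
    indicator_vector (decode r) + indicator_vector (decode q)"
proof (rule poly_mapping_eqI)
  fix e
  show "Poly_Mapping.lookup (indicator_vector (decode (swap_below b r q)) +
        indicator_vector (decode (swap_below b q r))) e =
      Poly_Mapping.lookup (indicator_vector (decode r) + indicator_vector (decode q)) e"
    using assms
    by (cases e) (auto simp: lookup_add lookup_indicator_vector mem_set_path_edges swap_below_def)
qed

text \<open>
  Swapping the tails changes only the terms pairing an index \<open>a \<le> b\<close> with an index \<open>d \<ge> c\<close>; the
  gain \<open>2 (y\<^sub>c - x\<^sub>c)\<close> at the pair \<open>(c, b)\<close> is the only change of order \<open>\<epsilon>\<^bsup>c - b\<^esup>\<close>.
\<close>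

lemma code_height_swap_below_less:
  assumes s: "\<And>i. i \<in> {1..n} \<Longrightarrow> s i \<ge> 1" "s (n + 1) = 2"
    and eps: "0 < \<epsilon>" "\<epsilon> < 1 / (real n * (1 + (\<Sum>j=2..n. (2 * real (s j) + 1))))"
    and r: "r \<in> codes s n" and q: "q \<in> codes s n"
    and bc: "1 \<le> b" "b < c" "c \<le> fst r" "c \<le> fst q" "snd r c < snd q c" "snd q b < snd r b"
      "\<forall>d\<in>{b<..<c}. snd r d = snd q d"
  shows "code_height \<epsilon> n (swap_below b r q) + code_height \<epsilon> n (swap_below b q r) <
    code_height \<epsilon> n r + code_height \<epsilon> n q"
proof -
  \<comment> \<open>The change of one term, after minus before. As \<open>code_height\<close>
    carries a minus sign, the total change has to be positive.\<close>
  define T where "T d a = height_term \<epsilon> (swap_below b r q) d a + height_term \<epsilon> (swap_below b q r) d a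
      - height_term \<epsilon> r d a - height_term \<epsilon> q d a" for d a
  define D where "D = 1 + (\<Sum>j=2..n. (2 * real (s j) + 1))"
  define \<Delta> where "\<Delta> = real (snd q c) - real (snd r c)"
  define \<eta> where "\<eta> = \<epsilon> ^ (c - b)"
  have Delta: "\<Delta> \<ge> 1" using bc(5) by (simp add: \<Delta>_def)
  have kr: "fst r \<le> n + 1" "snd r (fst r) < s (fst r)" "0 < snd r (fst r)"
    and kq: "fst q \<le> n + 1" "snd q (fst q) < s (fst q)" "0 < snd q (fst q)"
    using r q by (auto simp: codes_def)
  \<comment> \<open>At index \<open>n + 1\<close> there is a single source edge, so two routes
    cannot differ there.\<close>
  have cn: "c \<le> n"
  proof (rule ccontr)
    assume "\<not> c \<le> n"
    then have "fst r = n + 1" "fst q = n + 1" "c = n + 1" using kr kq bc by auto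
    then have "snd r c = 1" "snd q c = 1" using kr kq s(2) by auto
    with bc(5) show False by simp
  qed
  have n: "n \<ge> 1" using cn bc by simp
  have sc: "real (s c) \<ge> 1" using s(1)[of c] cn bc by auto
  \<comment> \<open>\<open>D - 1\<close> contains the summand for \<open>c\<close>, since
    \<open>c > b\<close> gives \<open>c \<ge> 2\<close>. Dropping this summand saves at least 3, and
    the index \<open>n + 1\<close>, where \<open>s\<close> is 2, costs 5.\<close>
  have tail: "(\<Sum>d=c+1..n+1. (2 * real (s d) + 1)) \<le> D + 1" and D: "D \<ge> 4"
  proof -
    have "(\<Sum>j=c..n. (2 * real (s j) + 1)) \<le> D - 1"
      unfolding D_def using bc by (simp, intro sum_mono2) auto
    moreover have "(\<Sum>j=c..n. (2 * real (s j) + 1)) = (2 * real (s c) + 1) + (\<Sum>j=c+1..n. (2 * real (s j) + 1))"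
      using cn by (simp add: sum.atLeast_Suc_atMost)
    moreover have "(\<Sum>d=c+1..n+1. (2 * real (s d) + 1)) = (\<Sum>d=c+1..n. (2 * real (s d) + 1)) + 5"
      using cn s(2) by simp
    moreover have "(\<Sum>j=c+1..n. (2 * real (s j) + 1)) \<ge> 0" by (intro sum_nonneg) auto
    ultimately show "(\<Sum>d=c+1..n+1. (2 * real (s d) + 1)) \<le> D + 1" "D \<ge> 4" using sc by linarith+
  qed
  have epsD: "\<epsilon> * real n * D < 1"
  proof -
    have "real n * D > 0" using n D by simp
    then show ?thesis using eps(2) unfolding D_def[symmetric] by (simp add: field_simps)
  qed
  have epsn: "\<epsilon> * real n < 1 / 4"
  proof -
    have "\<epsilon> * real n * 4 \<le> \<epsilon> * real n * D" using D eps(1) by (intro mult_left_mono) auto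
    then show ?thesis using epsD by linarith
  qed
  have eps1: "\<epsilon> \<le> 1"
  proof -
    have "\<epsilon> * 1 \<le> \<epsilon> * real n" using n eps(1) by (intro mult_left_mono) auto
    then show ?thesis using epsn by linarith
  qed
  have eta: "\<eta> > 0" using eps(1) by (simp add: \<eta>_def)
  have pow: "0 \<le> \<epsilon> ^ (d - a)" "\<epsilon> ^ (d - a) \<le> \<eta> * \<epsilon>" if "c - b < d - a" for d a
  proof -
    have "\<epsilon> ^ (d - a) \<le> \<epsilon> ^ Suc (c - b)"
      using that eps(1) eps1 by (intro power_decreasing) auto
    then show "\<epsilon> ^ (d - a) \<le> \<eta> * \<epsilon>" by (simp add: \<eta>_def mult.commute)
  qed (use eps(1) in simp)
  have dipb: "dip (snd r) b = 1" "dip (snd q) b = 0"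
    using bc codesD(4)[OF q, of b] codes_le[OF r, of b] by (auto simp: dip_def)
  have T_low: "T d a = 0" if "d < c" "a < d" for d a
  proof (cases "d \<le> b")
    case True
    then show ?thesis using that bc by (simp add: T_def height_term_def swap_below_def dip_def)
  next
    case False
    then have "snd r d = snd q d" using that bc by auto
    then show ?thesis using that False bc by (simp add: T_def height_term_def swap_below_def dip_def)
  qed
  have T_eq: "T d a = 0" if "b < a" "a < d" for d a
    using that by (simp add: T_def height_term_def swap_below_def dip_def)
  have T_c: "T c a = \<epsilon> ^ (c - a) * (2 * (dip (snd r) a - dip (snd q) a) * \<Delta>)" if "a \<le> b" for a
  proof -
    have "T c a = \<epsilon> ^ (c - a) * ((real (snd r c) + dip (snd q) a)\<^sup>2 + (real (snd q c) + dip (snd r) a)\<^sup>2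
       - (real (snd r c) + dip (snd r) a)\<^sup>2 - (real (snd q c) + dip (snd q) a)\<^sup>2)"
      using that bc by (simp add: T_def height_term_def swap_below_def dip_def algebra_simps)
    also have "(real (snd r c) + dip (snd q) a)\<^sup>2 + (real (snd q c) + dip (snd r) a)\<^sup>2
       - (real (snd r c) + dip (snd r) a)\<^sup>2 - (real (snd q c) + dip (snd q) a)\<^sup>2
       = 2 * (dip (snd r) a - dip (snd q) a) * \<Delta>"
      by (simp add: \<Delta>_def power2_eq_square algebra_simps)
    finally show ?thesis .
  qed
  have T_c_ge: "T c a \<ge> - (2 * \<Delta> * (\<eta> * \<epsilon>))" if "a < c" "a \<noteq> b" "1 \<le> a" for a
  proof (cases "a < b")
    case True
    have "dip (snd r) a - dip (snd q) a \<ge> - 1" by (simp add: dip_def)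
    then have "2 * (dip (snd r) a - dip (snd q) a) * \<Delta> \<ge> - (2 * \<Delta>)"
      using Delta by (auto simp: dip_def)
    then have "T c a \<ge> \<epsilon> ^ (c - a) * (- (2 * \<Delta>))"
      using T_c[of a] True eps(1) by (simp only: less_imp_le) (intro mult_left_mono, auto)
    moreover have "\<epsilon> ^ (c - a) * (2 * \<Delta>) \<le> \<eta> * \<epsilon> * (2 * \<Delta>)"
      using pow(2)[of c a] True bc Delta by (intro mult_right_mono) auto
    ultimately show ?thesis by (simp only: mult_minus_right mult.commute)
  next
    case False
    then have "T c a = 0" using T_eq that by auto
    then show ?thesis using Delta eta eps(1) by simp
  qed
  have T_high: "T d a \<ge> - ((2 * real (s d) + 1) * (\<eta> * \<epsilon>))" if "c < d" "a < d" "1 \<le> a" for d a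
  proof (cases "a \<le> b")
    case True
    \<comment> \<open>The coefficient of \<delta>_a in (t_d + \<delta>_a)^2, because \<delta>_a^2 =
      \<delta>_a. It is 0 for a route that starts below \<open>d\<close>, so the difference of the
      two coefficients can be as large as \<open>2 * s d + 1\<close>.\<close>
    define X where "X = (if d \<le> fst r then 2 * real (snd r d) + 1 else 0)"
    define Y where "Y = (if d \<le> fst q then 2 * real (snd q d) + 1 else 0)"
    have XY: "0 \<le> X" "X \<le> 2 * real (s d) + 1" "0 \<le> Y" "Y \<le> 2 * real (s d) + 1"
      using codes_le[OF r, of d] codes_le[OF q, of d] by (auto simp: X_def Y_def)
    have "T d a = \<epsilon> ^ (d - a) * ((dip (snd q) a - dip (snd r) a) * (X - Y))"
      using True that bc
      by (simp add: T_def height_term_def swap_below_def dip_def X_def Y_def power2_eq_square algebra_simps)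
    moreover have "(dip (snd q) a - dip (snd r) a) * (X - Y) \<ge> - (2 * real (s d) + 1)"
      using XY by (auto simp: dip_def)
    ultimately have "T d a \<ge> \<epsilon> ^ (d - a) * (- (2 * real (s d) + 1))"
      using eps(1) by (metis mult_left_mono zero_le_power less_imp_le)
    moreover have "\<epsilon> ^ (d - a) * (2 * real (s d) + 1) \<le> \<eta> * \<epsilon> * (2 * real (s d) + 1)"
      using pow(2)[of d a] True that bc by (intro mult_right_mono) auto
    ultimately show ?thesis by (simp add: algebra_simps)
  next
    case False
    then have "T d a = 0" using T_eq that by auto
    then show ?thesis using eta eps(1) by simp
  qed
  have lower_sum: "(\<Sum>a\<in>A. f a) \<ge> - (real n * B)"
    if "A \<subseteq> {1..n}" "B \<ge> 0" "\<And>a. a \<in> A \<Longrightarrow> f a \<ge> - B" for A :: "nat set" and B :: real and f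
  proof -
    have "card A \<le> n" using card_mono[OF _ that(1)] by simp
    then have "real (card A) * B \<le> real n * B" using that(2) by (intro mult_right_mono) auto
    then show ?thesis using sum_bounded_below[of A "- B" f] that(3) by simp
  qed
  have "(\<Sum>a=1..<c. T c a) \<ge> 2 * \<Delta> * \<eta> - real n * (2 * \<Delta> * (\<eta> * \<epsilon>))"
  proof -
    have "(\<Sum>a=1..<c. T c a) = T c b + (\<Sum>a\<in>{1..<c}-{b}. T c a)"
      using bc by (simp add: sum.remove)
    moreover have "T c b = 2 * \<Delta> * \<eta>" using T_c[of b] dipb by (simp add: \<eta>_def)
    moreover have "(\<Sum>a\<in>{1..<c}-{b}. T c a) \<ge> - (real n * (2 * \<Delta> * (\<eta> * \<epsilon>)))"
      using Delta eta eps(1) cn T_c_ge by (intro lower_sum) auto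
    ultimately show ?thesis by linarith
  qed
  moreover have "(\<Sum>d=1..<c. \<Sum>a=1..<d. T d a) = 0"
    using T_low by (intro sum.neutral ballI) auto
  moreover have "(\<Sum>d=c+1..n+1. \<Sum>a=1..<d. T d a) \<ge> - (real n * (D + 1) * (\<eta> * \<epsilon>))"
  proof -
    have "(\<Sum>d=c+1..n+1. \<Sum>a=1..<d. T d a) \<ge> (\<Sum>d=c+1..n+1. - (real n * ((2 * real (s d) + 1) * (\<eta> * \<epsilon>))))"
      using eta eps(1) T_high by (intro sum_mono lower_sum) auto
    also have "(\<Sum>d=c+1..n+1. - (real n * ((2 * real (s d) + 1) * (\<eta> * \<epsilon>)))) =
        - (real n * (\<Sum>d=c+1..n+1. (2 * real (s d) + 1)) * (\<eta> * \<epsilon>))"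
      by (simp only: sum_negf sum_distrib_left sum_distrib_right mult.assoc)
    finally have "(\<Sum>d=c+1..n+1. \<Sum>a=1..<d. T d a) \<ge>
        - (real n * (\<Sum>d=c+1..n+1. (2 * real (s d) + 1)) * (\<eta> * \<epsilon>))" .
    moreover have "real n * (\<Sum>d=c+1..n+1. (2 * real (s d) + 1)) * (\<eta> * \<epsilon>) \<le> real n * (D + 1) * (\<eta> * \<epsilon>)"
      using tail eta eps(1) by (intro mult_right_mono mult_left_mono) auto
    ultimately show ?thesis by linarith
  qed
  moreover have "(\<Sum>d=1..n+1. \<Sum>a=1..<d. T d a) =
      (\<Sum>d=1..<c. \<Sum>a=1..<d. T d a) + (\<Sum>a=1..<c. T c a) + (\<Sum>d=c+1..n+1. \<Sum>a=1..<d. T d a)"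
  proof -
    have "{1..n+1} = insert c ({1..<c} \<union> {c+1..n+1})" using bc cn by auto
    then show ?thesis by (simp only:) (subst sum.insert, simp, simp, subst sum.union_disjoint, auto)
  qed
  \<comment> \<open>Divided by \<open>\<eta>\<close>, the left side exceeds 2 \<Delta> - \<Delta>/2
    - 1 - 1/4, which is at least 1/4 because \<Delta> \<ge> 1.\<close>
  moreover have "2 * \<Delta> * \<eta> - real n * (2 * \<Delta> * (\<eta> * \<epsilon>)) - real n * (D + 1) * (\<eta> * \<epsilon>) > 0"
  proof -
    have "\<epsilon> * real n * \<Delta> \<le> 1 / 4 * \<Delta>" using epsn Delta by (intro mult_right_mono) auto
    then have "2 * \<Delta> - 2 * (\<epsilon> * real n * \<Delta>) - (\<epsilon> * real n * D + \<epsilon> * real n) > 0"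
      using epsD epsn Delta by linarith
    then have "\<eta> * (2 * \<Delta> - 2 * (\<epsilon> * real n * \<Delta>) - (\<epsilon> * real n * D + \<epsilon> * real n)) > 0"
      using eta by simp
    then show ?thesis by (simp add: algebra_simps)
  qed
  ultimately have "(\<Sum>d=1..n+1. \<Sum>a=1..<d. T d a) > 0" by linarith
  then show ?thesis
    unfolding T_def code_height_def by (simp add: sum.distrib sum_subtractf)
qed

text \<open>Testing each entry of the code against 0 recovers \<delta>, and the terms beyond
  \<open>k\<close> vanish by the cutoff in \<open>height_term\<close>.\<close>

lemma height_route_eq_code_height:
  assumes h: "\<And>k t \<delta>. k \<in> {1..n+1} \<Longrightarrow> t \<in> {1..s k - 1} \<Longrightarrow> \<delta> \<in> {1..k-1} \<rightarrow> {0, 1} \<Longrightarrow>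
           h (route s k t \<delta>) =
             (let t' = (\<lambda>c. if c = k then t else if \<delta> c = 0 then 0 else s c)
              in - (\<Sum>c=1..k. \<Sum>a=1..<c. \<epsilon> ^ (c - a) * (real (t' c) + real (\<delta> a))\<^sup>2))"
    and r: "r \<in> codes s n"
  shows "h (decode r) = code_height \<epsilon> n r"
proof -
  obtain k x where kx: "r = (k, x)" by (cases r)
  have k: "k \<in> {1..n+1}" "0 < x k" "x k < s k" "\<And>c. 1 \<le> c \<Longrightarrow> c < k \<Longrightarrow> x c = 0 \<or> x c = s c"
    using r by (auto simp: kx codes_def)
  define \<delta> where "\<delta> a = (if x a = 0 then 0 else 1 :: nat)" for a
  have x: "(if c = k then x k else if \<delta> c = 0 then 0 else s c) = x c" if "c \<in> {1..k}" for c
    using k(4)[of c] that by (auto simp: \<delta>_def)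
  have delta: "real (\<delta> a) = dip x a" for a by (simp add: \<delta>_def dip_def)
  have "x c = \<delta> c * s c" if "c \<in> {1..<k}" for c
    using k(4)[of c] that by (auto simp: \<delta>_def)
  then have "route s k (x k) \<delta> = decode r"
    using k(1) by (cases k) (auto simp: route_def kx path_edges_conv_map)
  then have "h (decode r) = (let t' = (\<lambda>c. if c = k then x k else if \<delta> c = 0 then 0 else s c)
              in - (\<Sum>c=1..k. \<Sum>a=1..<c. \<epsilon> ^ (c - a) * (real (t' c) + real (\<delta> a))\<^sup>2))"
    using h[of k "x k" \<delta>] k by (auto simp: \<delta>_def)
  also have "\<dots> = - (\<Sum>c=1..k. \<Sum>a=1..<c. \<epsilon> ^ (c - a) * (real (x c) + dip x a)\<^sup>2)"
    unfolding Let_def delta by (intro arg_cong[where f = uminus] sum.cong refl) (simp only: x)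
  also have "(\<Sum>c=1..k. \<Sum>a=1..<c. \<epsilon> ^ (c - a) * (real (x c) + dip x a)\<^sup>2) =
      (\<Sum>c=1..n+1. \<Sum>a=1..<c. height_term \<epsilon> r c a)"
    using k(1) by (intro sum.mono_neutral_cong_left) (auto simp: height_term_def kx)
  finally show ?thesis by (simp add: code_height_def)
qed

lemma crossing_exchange:
  assumes s: "\<And>i. i \<in> {1..n} \<Longrightarrow> s i \<ge> 1" "s (n + 1) = 2"
    and eps: "0 < \<epsilon>" "\<epsilon> < 1 / (real n * (1 + (\<Sum>j=2..n. (2 * real (s j) + 1))))"
    and r: "r \<in> codes s n" and q: "q \<in> codes s n" and "crossing r q"
  shows "\<exists>r'\<in>codes s n. \<exists>q'\<in>codes s n.
    indicator_vector (decode r') + indicator_vector (decode q') =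
      indicator_vector (decode r) + indicator_vector (decode q) \<and>
    code_height \<epsilon> n r' + code_height \<epsilon> n q' < code_height \<epsilon> n r + code_height \<epsilon> n q"
proof -
  obtain b c where bc: "1 \<le> b" "b < c" "c \<le> fst r" "c \<le> fst q" "snd r c < snd q c"
      "snd q b < snd r b" "\<forall>d\<in>{b<..<c}. snd r d = snd q d"
    using \<open>crossing r q\<close> by (auto simp: crossing_def enters_below_def)
  have b: "b < fst r" "b < fst q" using bc by auto
  show ?thesis
    using swap_below_mem_codes[OF r q b] swap_below_mem_codes[OF q r b(2,1)]
      indicator_vector_swap_below[OF b] code_height_swap_below_less[OF s eps r q bc] by blast
qed

theorem theorem6p28:
  fixes s :: "nat \<Rightarrow> nat" and n :: nat and \<epsilon> :: real
    and h :: "(nat \<times> nat) list \<Rightarrow> real"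
  assumes "n \<ge> 1"
    and "\<And>i. i \<in> {1..n} \<Longrightarrow> s i \<ge> 1"
    and "s (n + 1) = 2"
    and "0 < \<epsilon>"
    and "\<epsilon> < 1 / (real n * (1 + (\<Sum>j=2..n. (2 * real (s j) + 1))))"
    and "\<And>k t \<delta>. k \<in> {1..n+1} \<Longrightarrow> t \<in> {1..s k - 1} \<Longrightarrow> \<delta> \<in> {1..k-1} \<rightarrow> {0, 1} \<Longrightarrow>
           h (route s k t \<delta>) =
             (let t' = (\<lambda>c. if c = k then t else if \<delta> c = 0 then 0 else s c)
              in - (\<Sum>c=1..k. \<Sum>a=1..<c. \<epsilon> ^ (c - a) * (real (t' c) + real (\<delta> a))\<^sup>2))"
  shows "admissible_height_function s n h"
proof -
  have routes: "routes s n = decode ` codes s n"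
    by (rule routes_eq_decode) (fact assms(2))
  have h: "h (decode r) = code_height \<epsilon> n r" if "r \<in> codes s n" for r
    using height_route_eq_code_height[OF assms(6) that] .
  have "{fst ` F | F. lower_face F (convex hull ((\<lambda>P. (indicator_vector P, h P)) ` routes s n))} =
      {convex hull (indicator_vector ` C) | C.
         C \<subseteq> routes s n \<and> C \<noteq> {} \<and> pairwise (coherent s n) C}"
  proof (rule lower_faces_eq_coherent_sets)
    show "finite (routes s n)"
      unfolding routes by (intro finite_imageI finite_codes)
    show "Poly_Mapping.lookup (indicator_vector P) e \<ge> 0" for P :: "(nat \<times> nat) list" and e
      by (simp add: lookup_indicator_vector)
    show "indicator_vector P \<noteq> 0" if P: "P \<in> routes s n" for P
    proof -
      obtain r where r: "r \<in> codes s n" "P = decode r" using P unfolding routes by blast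
      have "(fst r, snd r (fst r)) \<in> set P"
        using codesD(1)[OF r(1)] by (simp add: r(2) mem_set_path_edges)
      then have "Poly_Mapping.lookup (indicator_vector P) (fst r, snd r (fst r)) = 1"
        by (simp add: lookup_indicator_vector)
      then show ?thesis by (metis lookup_zero zero_neq_one)
    qed
  next
    fix P Q assume P: "P \<in> routes s n" and Q: "Q \<in> routes s n" and "\<not> coherent s n P Q"
    obtain r q where r: "r \<in> codes s n" "P = decode r" and q: "q \<in> codes s n" "Q = decode q"
      using P Q unfolding routes by blast
    consider "crossing r q" | "crossing q r"
      using crossing_if_not_coherent \<open>\<not> coherent s n P Q\<close> r q by blast
    then obtain r' q' where rq: "r' \<in> codes s n" "q' \<in> codes s n"
      "indicator_vector (decode r') + indicator_vector (decode q') = indicator_vector P + indicator_vector Q"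
      "code_height \<epsilon> n r' + code_height \<epsilon> n q' < code_height \<epsilon> n r + code_height \<epsilon> n q"
      using crossing_exchange[OF assms(2-5) r(1) q(1)] crossing_exchange[OF assms(2-5) q(1) r(1)]
      unfolding r(2) q(2) by cases (blast, metis add.commute)
    then show "\<exists>P'\<in>routes s n. \<exists>Q'\<in>routes s n.
        indicator_vector P' + indicator_vector Q' = indicator_vector P + indicator_vector Q \<and>
        h P' + h Q' < h P + h Q"
      using h r q unfolding routes
      by (intro bexI[of _ "decode r'"] bexI[of _ "decode q'"]) auto
  next
    fix u w :: "(nat \<times> nat) list \<Rightarrow> real"
    assume u: "\<And>P. P \<in> routes s n \<Longrightarrow> u P \<ge> 0" and w: "\<And>P. P \<in> routes s n \<Longrightarrow> w P \<ge> 0"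
      and ucoh: "pairwise (coherent s n) {P \<in> routes s n. u P \<noteq> 0}"
      and wcoh: "pairwise (coherent s n) {P \<in> routes s n. w P \<noteq> 0}"
      and eq: "(\<Sum>P\<in>routes s n. u P *\<^sub>R indicator_vector P) = (\<Sum>P\<in>routes s n. w P *\<^sub>R indicator_vector P)"
    have noncross: "\<not> crossing q p"
      if "q \<in> codes s n" "p \<in> codes s n" "v (decode q) \<noteq> 0" "v (decode p) \<noteq> 0"
        "pairwise (coherent s n) {P \<in> routes s n. v P \<noteq> 0}" for v :: "_ \<Rightarrow> real" and q p
    proof
      assume cr: "crossing q p"
      then have "q \<noteq> p" by (auto simp: crossing_def)
      then have "decode q \<noteq> decode p" using inj_onD[OF inj_on_decode _ that(1,2)] by blast
      then have "coherent s n (decode q) (decode p)"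
        using pairwiseD[OF that(5), of "decode q" "decode p"] that(1-4) unfolding routes by blast
      with not_coherent_if_crossing(1)[OF cr] show False by blast
    qed
    \<comment> \<open>Read at a single edge, equality of the two flows says that the routes through
      this edge have the same total weight, which is the hypothesis \<open>flow\<close> of the
      uniqueness lemma.\<close>
    have mass: "sum (\<lambda>r. v (decode r)) {r \<in> codes s n. e \<in> set (decode r)} =
        Poly_Mapping.lookup (\<Sum>P\<in>routes s n. v P *\<^sub>R indicator_vector P) e"
      for v :: "_ \<Rightarrow> real" and e
    proof -
      have "Poly_Mapping.lookup (\<Sum>P\<in>routes s n. v P *\<^sub>R indicator_vector P) e =
          (\<Sum>P\<in>routes s n. if e \<in> set P then v P else 0)"
        by (auto simp: lookup_sum lookup_indicator_vector intro!: sum.cong)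
      also have "\<dots> = (\<Sum>r\<in>codes s n. if e \<in> set (decode r) then v (decode r) else 0)"
        unfolding routes by (simp only: sum.reindex[OF inj_on_decode] o_def)
      also have "\<dots> = sum (\<lambda>r. v (decode r)) {r \<in> codes s n. e \<in> set (decode r)}"
        by (rule sum.inter_filter[OF finite_codes, symmetric])
      finally show ?thesis ..
    qed
    have "u (decode r) = w (decode r)" if "r \<in> codes s n" for r
    proof (rule noncrossing_decomposition_unique[where u = "\<lambda>r. u (decode r)" and w = "\<lambda>r. w (decode r)"])
      show "u (decode q) \<ge> 0" "w (decode q) \<ge> 0" if "q \<in> codes s n" for q
        using u w that unfolding routes by blast+
      show "\<not> crossing q p"
        if "q \<in> codes s n" "p \<in> codes s n" "u (decode q) \<noteq> 0" "u (decode p) \<noteq> 0" for q p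
        using noncross[OF that ucoh] .
      show "\<not> crossing q p"
        if "q \<in> codes s n" "p \<in> codes s n" "w (decode q) \<noteq> 0" "w (decode p) \<noteq> 0" for q p
        using noncross[OF that wcoh] .
      show "sum (\<lambda>r. u (decode r)) {q \<in> codes s n. e \<in> set (decode q)} =
          sum (\<lambda>r. w (decode r)) {q \<in> codes s n. e \<in> set (decode q)}" for e
        unfolding mass eq ..
    qed (use that assms(2) in auto)
    then show "\<forall>P\<in>routes s n. u P = w P" unfolding routes by blast
  qed
  then show ?thesis
    unfolding admissible_height_function_def dkk_triangulation_def .
qed

end
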